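(* For every $0<\alpha<\beta<1$, there exists $x_{\alpha,\beta}\in(0,1)$ such that the function $x\mapsto E_\alpha(-x^\alpha)-E_\beta(-x^\beta)$ is negative for $x\in(0,x_{\alpha,\beta})$ and positive for $x\in(x_{\alpha,\beta},\infty)$. Moreover, $$\left(\frac{1}{\Gamma(1-\beta)\Gamma(1+\alpha)}\right)^{\frac{1}{\beta-\alpha}} < x_{\alpha,\beta} < \left(\frac{\Gamma(1+\beta)}{\Gamma(1+\alpha)}\right)^{\frac{1}{\beta-\alpha}}.$$
   Context: For $\alpha>0$, $E_\alpha$ denotes the Mittag-Leffler function $E_\alpha(z)=\sum_{n\ge 0} \frac{z^n}{\Gamma(1+n\alpha)}$, where $\Gamma$ is the Gamma function. *)

theory Defs
  imports "HOL-Analysis.Analysis"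
begin

definition mittag_leffler :: "real \<Rightarrow> real \<Rightarrow> real" where
  "mittag_leffler \<alpha> z = (\<Sum>n. z ^ n / Gamma (1 + real n * \<alpha>))"

end

theory Submission
  imports Defs "HOL-Complex_Analysis.Complex_Analysis" "HOL-Real_Asymp.Real_Asymp"
begin

text \<open>
  On \<open>x \<ge> 0\<close>, the function \<open>E_\<alpha>(-x^\<alpha>)\<close> is the Laplace transform of a probability density; after the
  substitution \<open>t = exp v\<close> this density is the even function \<open>strip_kernel \<alpha>\<close>, the Poisson kernel of a strip.
  The representation holds because both sides have the Laplace transform \<open>1 / (s (1 + s^(-\<alpha>)))\<close>: termwise
  integration gives it for the series, the residue theorem for the density.

  Let \<open>H\<close> be the difference of the distribution functions for \<open>\<alpha>\<close> and \<open>\<beta>\<close>. It is odd in \<open>v\<close> and negative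
  for \<open>v > 0\<close>. For \<open>F(x) = E_\<alpha>(-x^\<alpha>) - E_\<beta>(-x^\<beta>)\<close>, integration by parts shows that \<open>exp x * F(x) / x\<close> is the
  integral of \<open>exp v * exp (x * (1 - exp v)) * H(v)\<close>, which increases strictly with \<open>x\<close> and is positive at
  \<open>x = 1\<close> by the reflection \<open>v \<mapsto> -v\<close>. So \<open>F\<close> has at most one zero, and it lies below \<open>1\<close>.

  The function \<open>e(x) = E_\<alpha>(-x^\<alpha>)\<close> solves \<open>e + I^\<alpha> e = 1\<close> with the fractional integral \<open>I^\<alpha>\<close>. As \<open>e\<close> decreases,
  this gives \<open>1 / (1 + \<Gamma>(1-\<alpha>) x^\<alpha>) \<le> e(x) < 1 / (1 + x^\<alpha> / \<Gamma>(1+\<alpha>))\<close>, hence the lower bound for the zero. The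
  upper bound follows by comparing the two Volterra equations at the zero.
\<close>

subsection \<open>The kernel and its distribution function\<close>

text \<open>With t = exp v, the measure with density \<open>strip_kernel \<alpha>\<close> in v
  becomes sin(pi \<alpha>) t^(\<alpha> - 1) / (pi (t^(2 \<alpha>) + 2 t^\<alpha> cos(pi \<alpha>) +
  1)) dt, the spectral density of the Mittag-Leffler function. In the logarithmic variable its
  symmetry under t -> 1/t is evenness.\<close>

definition strip_kernel :: "real \<Rightarrow> real \<Rightarrow> real" where
  "strip_kernel \<alpha> v = sin (pi * \<alpha>) / (2 * pi * (cosh (\<alpha> * v) + cos (pi * \<alpha>)))"

text \<open>An antiderivative of the kernel in closed form. The difference of \<open>pi / 2\<close>
  and the arctangent is an arc cotangent that falls from pi \<alpha> at -infinity to 0 at infinity,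
  so the constants normalise the limits to 0 and 1.\<close>

definition strip_cdf :: "real \<Rightarrow> real \<Rightarrow> real" where
  "strip_cdf \<alpha> v =
     1 - (pi / 2 - arctan ((exp (\<alpha> * v) + cos (pi * \<alpha>)) / sin (pi * \<alpha>))) / (pi * \<alpha>)"

lemma sin_pi_mult_pos: "0 < \<alpha> \<Longrightarrow> \<alpha> < 1 \<Longrightarrow> 0 < sin (pi * \<alpha>)"
  by (intro sin_gt_zero) auto

lemma cosh_add_cos_pos:
  fixes \<alpha> v :: real
  assumes "0 < \<alpha>" "\<alpha> < 1"
  shows "0 < cosh (\<alpha> * v) + cos (pi * \<alpha>)"
proof -
  have "sin (pi * \<alpha>) \<noteq> 0"
    using sin_pi_mult_pos[OF assms] by simp
  then have "cos (pi * \<alpha>) \<noteq> -1"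
    using sin_cos_squared_add[of "pi * \<alpha>"] by (metis add_cancel_left_left power2_minus power_one zero_eq_power2)
  then have "cos (pi * \<alpha>) > -1"
    using cos_ge_minus_one[of "pi * \<alpha>"] by linarith
  then show ?thesis
    using cosh_real_ge_1[of "\<alpha> * v"] by linarith
qed

lemma strip_kernel_pos: "0 < \<alpha> \<Longrightarrow> \<alpha> < 1 \<Longrightarrow> 0 < strip_kernel \<alpha> v"
  unfolding strip_kernel_def
  by (intro divide_pos_pos mult_pos_pos sin_pi_mult_pos cosh_add_cos_pos) auto

lemma strip_kernel_even: "strip_kernel \<alpha> (- v) = strip_kernel \<alpha> v"
  by (simp add: strip_kernel_def)

lemma continuous_on_strip_kernel:
  assumes "0 < \<alpha>" "\<alpha> < 1"
  shows "continuous_on S (strip_kernel \<alpha>)"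
  unfolding strip_kernel_def[abs_def] using cosh_add_cos_pos[OF assms]
  by (intro continuous_intros) (auto simp: less_imp_neq[symmetric])

lemma borel_measurable_strip_kernel:
  assumes "0 < \<alpha>" "\<alpha> < 1"
  shows "strip_kernel \<alpha> \<in> borel_measurable borel"
  by (rule borel_measurable_continuous_onI[OF continuous_on_strip_kernel[OF assms]])

lemma strip_cdf_deriv:
  assumes "0 < \<alpha>" "\<alpha> < 1"
  shows "(strip_cdf \<alpha> has_real_derivative strip_kernel \<alpha> v) (at v)"
proof -
  define s c u where "s = sin (pi * \<alpha>)" and "c = cos (pi * \<alpha>)" and "u = exp (\<alpha> * v)"
  have s: "s > 0" unfolding s_def by (rule sin_pi_mult_pos) fact+
  have u: "u > 0" by (simp add: u_def)
  have sc: "s\<^sup>2 + c\<^sup>2 = 1" by (simp add: s_def c_def)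
  have "(strip_cdf \<alpha> has_real_derivative
      (\<alpha> * u / s * inverse (1 + ((u + c) / s)\<^sup>2)) / (pi * \<alpha>)) (at v)"
    unfolding strip_cdf_def[abs_def]
    by (rule derivative_eq_intros refl | use assms s in \<open>simp add: s_def c_def u_def\<close>)+
  also have "1 + ((u + c) / s)\<^sup>2 = (u\<^sup>2 + 2 * u * c + 1) / s\<^sup>2"
    using s sc by (simp add: field_simps power2_eq_square)
  also have "(\<alpha> * u / s * inverse ((u\<^sup>2 + 2 * u * c + 1) / s\<^sup>2)) / (pi * \<alpha>) = strip_kernel \<alpha> v"
  proof -
    have e: "cosh (\<alpha> * v) + c = (u\<^sup>2 + 2 * u * c + 1) / (2 * u)"
      using u by (simp add: cosh_def u_def exp_minus field_simps power2_eq_square)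
    have "cosh (\<alpha> * v) + c > 0"
      unfolding c_def by (rule cosh_add_cos_pos) fact+
    then have "u\<^sup>2 + 2 * u * c + 1 > 0"
      using u e by (simp add: zero_less_divide_iff)
    moreover have "(\<alpha> * u / s * inverse (d / s\<^sup>2)) / (pi * \<alpha>) = s / (2 * pi * (d / (2 * u)))"
      if "d > 0" for d
      using that u s assms by (simp add: field_simps power2_eq_square)
    ultimately show ?thesis
      unfolding strip_kernel_def c_def[symmetric] s_def[symmetric] e by blast
  qed
  finally show ?thesis .
qed

lemma filterlim_cmult_at_bot: "0 < (c::real) \<Longrightarrow> filterlim (\<lambda>v. c * v) at_bot at_bot"
  by (rule filterlim_tendsto_pos_mult_at_bot[OF tendsto_const _ filterlim_ident])

lemma arctan_cot:
  assumes "0 < x" "x < pi"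
  shows "arctan (cos x / sin x) = pi / 2 - x"
proof -
  have "cos x / sin x = tan (pi / 2 - x)"
    by (simp add: tan_def sin_diff cos_diff)
  then show ?thesis
    using assms by (simp add: arctan_tan)
qed

lemma strip_cdf_at_bot:
  assumes "0 < \<alpha>" "\<alpha> < 1"
  shows "(strip_cdf \<alpha> \<longlongrightarrow> 0) at_bot"
proof -
  have s: "sin (pi * \<alpha>) > 0" by (rule sin_pi_mult_pos) fact+
  have "((\<lambda>v. exp (\<alpha> * v)) \<longlongrightarrow> 0) at_bot"
    by (rule filterlim_compose[OF exp_at_bot filterlim_cmult_at_bot]) fact
  then have "(strip_cdf \<alpha> \<longlongrightarrow>
      1 - (pi / 2 - arctan ((0 + cos (pi * \<alpha>)) / sin (pi * \<alpha>))) / (pi * \<alpha>)) at_bot"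
    unfolding strip_cdf_def[abs_def] using s assms
    by (intro tendsto_intros) auto
  also have "arctan ((0 + cos (pi * \<alpha>)) / sin (pi * \<alpha>)) = pi / 2 - pi * \<alpha>"
    using arctan_cot[of "pi * \<alpha>"] assms by simp
  finally show ?thesis using assms by simp
qed

lemma strip_cdf_at_top:
  assumes "0 < \<alpha>" "\<alpha> < 1"
  shows "(strip_cdf \<alpha> \<longlongrightarrow> 1) at_top"
proof -
  have s: "sin (pi * \<alpha>) > 0" by (rule sin_pi_mult_pos) fact+
  have "filterlim (\<lambda>v. exp (\<alpha> * v)) at_top at_top"
    by (rule filterlim_compose[OF exp_at_top])
       (rule filterlim_tendsto_pos_mult_at_top[OF tendsto_const assms(1) filterlim_ident])
  then have "filterlim (\<lambda>v. cos (pi * \<alpha>) + exp (\<alpha> * v)) at_top at_top"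
    by (rule filterlim_tendsto_add_at_top[OF tendsto_const])
  then have "filterlim (\<lambda>v. inverse (sin (pi * \<alpha>)) * (cos (pi * \<alpha>) + exp (\<alpha> * v))) at_top at_top"
    using s by (intro filterlim_tendsto_pos_mult_at_top[OF tendsto_const]) auto
  then have "((\<lambda>v. arctan ((exp (\<alpha> * v) + cos (pi * \<alpha>)) / sin (pi * \<alpha>))) \<longlongrightarrow> pi / 2) at_top"
    by (intro filterlim_compose[OF tendsto_arctan_at_top]) (simp add: field_simps)
  then have "(strip_cdf \<alpha> \<longlongrightarrow> 1 - (pi / 2 - pi / 2) / (pi * \<alpha>)) at_top"
    unfolding strip_cdf_def[abs_def] using assms
    by (intro tendsto_intros) auto
  then show ?thesis by simp
qed

lemma strip_kernel_integrable:
  assumes "0 < \<alpha>" "\<alpha> < 1"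
  shows "integrable lborel (strip_kernel \<alpha>)"
proof -
  have "set_integrable lborel (einterval (-\<infinity>) \<infinity>) (strip_kernel \<alpha>)"
  proof (rule interval_integral_FTC_nonneg)
    show "DERIV (strip_cdf \<alpha>) v :> strip_kernel \<alpha> v" for v
      by (rule strip_cdf_deriv) fact+
    show "isCont (strip_kernel \<alpha>) v" for v
      using continuous_on_strip_kernel[OF assms, of UNIV] by (auto simp: continuous_on_eq_continuous_at)
    show "((strip_cdf \<alpha> \<circ> real_of_ereal) \<longlongrightarrow> 0) (at_right (-\<infinity>))"
      "((strip_cdf \<alpha> \<circ> real_of_ereal) \<longlongrightarrow> 1) (at_left \<infinity>)"
      using strip_cdf_at_bot[OF assms] strip_cdf_at_top[OF assms]
      by (simp_all add: ereal_tendsto_simps)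
  qed (use strip_kernel_pos[OF assms] in \<open>auto intro: less_imp_le\<close>)
  then show ?thesis by (simp add: set_integrable_def)
qed

lemma strip_cdf_strict_mono:
  assumes "0 < \<alpha>" "\<alpha> < 1" "v < w"
  shows "strip_cdf \<alpha> v < strip_cdf \<alpha> w"
  using strip_cdf_deriv[OF assms(1,2)] strip_kernel_pos[OF assms(1,2)]
  by (intro DERIV_pos_imp_increasing[OF assms(3)]) blast

lemma strip_cdf_continuous:
  assumes "0 < \<alpha>" "\<alpha> < 1"
  shows "continuous_on S (strip_cdf \<alpha>)"
  using strip_cdf_deriv[OF assms] DERIV_isCont continuous_at_imp_continuous_on by blast

text \<open>The kernel is even, so the sum of the values at v and -v has derivative zero; the limit
  at infinity fixes the constant.\<close>

lemma strip_cdf_reflect: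
  assumes "0 < \<alpha>" "\<alpha> < 1"
  shows "strip_cdf \<alpha> (- v) = 1 - strip_cdf \<alpha> v"
proof -
  define f where "f v = strip_cdf \<alpha> v + strip_cdf \<alpha> (- v)" for v
  have d: "DERIV f v :> 0" for v
    unfolding f_def
    by (rule derivative_eq_intros DERIV_chain2[OF strip_cdf_deriv[OF assms]] strip_cdf_deriv[OF assms] refl
        | simp add: strip_kernel_even)+
  then have c: "f w = f v" for w
    by (rule DERIV_isconst_all[rule_format])
  have "((\<lambda>v. strip_cdf \<alpha> (- v)) \<longlongrightarrow> 0) at_top"
    by (rule filterlim_compose[OF strip_cdf_at_bot[OF assms] filterlim_uminus_at_bot_at_top])
  then have "(f \<longlongrightarrow> 1 + 0) at_top"
    unfolding f_def[abs_def] by (intro tendsto_add strip_cdf_at_top assms)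
  moreover have "f = (\<lambda>_. f v)" using c by auto
  ultimately have "f v = 1"
    by (metis tendsto_const_iff trivial_limit_at_top_linorder add.right_neutral)
  then show ?thesis by (simp add: f_def)
qed

lemma strip_cdf_bounds:
  assumes "0 < \<alpha>" "\<alpha> < 1"
  shows "0 < strip_cdf \<alpha> v" "strip_cdf \<alpha> v < 1"
proof -
  show pos: "0 < strip_cdf \<alpha> v" for v
  proof -
    have "0 \<le> strip_cdf \<alpha> (v - 1)"
    proof (rule tendsto_upperbound[OF strip_cdf_at_bot[OF assms]])
      show "\<forall>\<^sub>F w in at_bot. strip_cdf \<alpha> w \<le> strip_cdf \<alpha> (v - 1)"
        using eventually_le_at_bot[of "v - 1"]
        by eventually_elim (metis assms strip_cdf_strict_mono order_le_less)
    qed simp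
    also have "\<dots> < strip_cdf \<alpha> v" by (rule strip_cdf_strict_mono) (use assms in auto)
    finally show ?thesis .
  qed
  show "strip_cdf \<alpha> v < 1"
    using pos[of "-v"] strip_cdf_reflect[OF assms, of v] by simp
qed

section \<open>Comparison of the distribution functions for two indices\<close>

lemma sin_ratio_antimono:
  fixes p q a b :: real
  assumes "0 < p" "p < q" "q < 1" "0 < a" "a \<le> b" "b < pi"
  shows "sin (b * q) / sin (b * p) \<le> sin (a * q) / sin (a * p)"
proof -
  \<comment> \<open>\<open>w\<close> is the numerator of the derivative of sin(t q) / sin(t p). It
    vanishes at 0, and its own derivative (p^2 - q^2) sin(t q) sin(t p) is nonpositive because p < q
    and both arguments stay below pi.\<close>
  define w where "w t = q * cos (t * q) * sin (t * p) - p * sin (t * q) * cos (t * p)" for t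
  have s: "0 < sin (t * r)" if "0 < t" "t \<le> b" "0 < r" "r < 1" for t r
  proof -
    have "t * r < t * 1" using that by (intro mult_strict_left_mono) auto
    then have "t * r < pi" using that assms by linarith
    then show ?thesis using that by (intro sin_gt_zero) auto
  qed
  have w: "w t \<le> 0" if t: "0 \<le> t" "t \<le> b" for t
  proof -
    have "w t \<le> w 0"
    proof (rule DERIV_nonpos_imp_nonincreasing[OF t(1)])
      fix x assume x: "0 \<le> x" "x \<le> t"
      have "DERIV w x :> (p\<^sup>2 - q\<^sup>2) * (sin (x * q) * sin (x * p))"
        unfolding w_def
        by (auto intro!: derivative_eq_intros simp: algebra_simps power2_eq_square)
      moreover have "(p\<^sup>2 - q\<^sup>2) * (sin (x * q) * sin (x * p)) \<le> 0"
      proof (rule mult_nonpos_nonneg)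
        show "p\<^sup>2 - q\<^sup>2 \<le> 0" using assms by (simp add: power_mono)
        show "0 \<le> sin (x * q) * sin (x * p)"
          using s[of x p] s[of x q] x t assms by (cases "x = 0") auto
      qed
      ultimately show "\<exists>y. DERIV w x :> y \<and> y \<le> 0" by blast
    qed
    then show ?thesis by (simp add: w_def)
  qed
  show ?thesis
  proof (rule DERIV_nonpos_imp_nonincreasing[OF assms(5)])
    fix x assume x: "a \<le> x" "x \<le> b"
    have "sin (x * p) > 0" using s[of x p] x assms by auto
    then have "((\<lambda>t. sin (t * q) / sin (t * p)) has_real_derivative w x / (sin (x * p))\<^sup>2) (at x)"
      unfolding w_def
      by (auto intro!: derivative_eq_intros simp: power2_eq_square algebra_simps)
    moreover have "w x / (sin (x * p))\<^sup>2 \<le> 0"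
      using w[of x] x assms by (intro divide_nonpos_nonneg) auto
    ultimately show "\<exists>y. ((\<lambda>t. sin (t * q) / sin (t * p)) has_real_derivative y) (at x) \<and> y \<le> 0"
      by blast
  qed
qed

text \<open>With \<open>p = 1 - strip_cdf \<alpha> v\<close>, the definition of the distribution function says
  \<open>exp (\<alpha> * v) = sin (pi * \<alpha> * (1 - p)) / sin (pi * \<alpha> * p)\<close>; the left side increases and the
  right side decreases with \<open>\<alpha>\<close>.\<close>

lemma strip_cdf_less:
  assumes "0 < \<alpha>" "\<alpha> < \<beta>" "\<beta> < 1" "0 < v"
  shows "strip_cdf \<alpha> v < strip_cdf \<beta> v"
proof -
  define p where "p = 1 - strip_cdf \<alpha> v"
  have \<alpha>: "\<alpha> < 1" "0 < \<beta>" using assms by auto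
  \<comment> \<open>Reflection at 0 gives the value 1/2, so \<open>0 < v\<close> forces
    \<open>p < 1 / 2\<close>. This is the condition p < 1 - p of \<open>sin_ratio_antimono\<close>,
    which is applied below between the angles pi \<alpha> and pi \<beta>.\<close>
  have "strip_cdf \<alpha> 0 = 1 / 2"
    using strip_cdf_reflect[OF assms(1) \<alpha>(1), of 0] by simp
  then have p: "0 < p" "p < 1 / 2"
    using strip_cdf_bounds[OF assms(1) \<alpha>(1), of v] strip_cdf_strict_mono[OF assms(1) \<alpha>(1) assms(4)]
    by (auto simp: p_def)
  have ap: "0 < pi * \<alpha> * p" "pi * \<alpha> * p < pi / 2" "0 < pi * \<beta> * p" "pi * \<beta> * p < pi / 2"
  proof -
    have "\<alpha> * p < 1 * (1/2)" "\<beta> * p < 1 * (1/2)" using assms p by (intro mult_strict_mono; simp)+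
    then show "pi * \<alpha> * p < pi / 2" "pi * \<beta> * p < pi / 2" by (auto simp: mult.assoc)
  qed (use assms p in auto)
  have sa: "sin (pi * \<alpha>) > 0" "sin (pi * \<beta>) > 0"
    using assms by (auto intro: sin_pi_mult_pos)
  have sp: "sin (pi * \<alpha> * p) > 0" "sin (pi * \<beta> * p) > 0"
    using ap by (auto intro!: sin_gt_zero2)
  have "arctan ((exp (\<alpha> * v) + cos (pi * \<alpha>)) / sin (pi * \<alpha>)) = pi / 2 - pi * \<alpha> * p"
    using assms by (simp add: p_def strip_cdf_def)
  also have "\<dots> = arctan (cos (pi * \<alpha> * p) / sin (pi * \<alpha> * p))"
    using ap by (intro arctan_cot[symmetric]) auto
  finally have eq: "(exp (\<alpha> * v) + cos (pi * \<alpha>)) / sin (pi * \<alpha>) = cos (pi * \<alpha> * p) / sin (pi * \<alpha> * p)"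
    by (simp add: arctan_eq_iff)
  have split: "sin (pi * \<gamma> * (1 - p)) / sin (pi * \<gamma> * p)
      = sin (pi * \<gamma>) * (cos (pi * \<gamma> * p) / sin (pi * \<gamma> * p)) - cos (pi * \<gamma>)"
    if "sin (pi * \<gamma> * p) > 0" for \<gamma>
    using that by (simp add: right_diff_distrib sin_diff field_simps)
  have "sin (pi * \<beta> * (1 - p)) / sin (pi * \<beta> * p) \<le> sin (pi * \<alpha> * (1 - p)) / sin (pi * \<alpha> * p)"
    using assms p by (intro sin_ratio_antimono) auto
  also have "\<dots> = exp (\<alpha> * v)"
    unfolding split[OF sp(1)] eq[symmetric] using sa by simp
  also have "\<dots> < exp (\<beta> * v)" using assms by simp
  finally have "cos (pi * \<beta> * p) / sin (pi * \<beta> * p) < (exp (\<beta> * v) + cos (pi * \<beta>)) / sin (pi * \<beta>)"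
    unfolding split[OF sp(2)] using sa by (simp add: field_simps)
  then have "arctan (cos (pi * \<beta> * p) / sin (pi * \<beta> * p))
      < arctan ((exp (\<beta> * v) + cos (pi * \<beta>)) / sin (pi * \<beta>))"
    by (simp add: arctan_less_iff)
  then have "pi / 2 - arctan ((exp (\<beta> * v) + cos (pi * \<beta>)) / sin (pi * \<beta>)) < pi * \<beta> * p"
    using arctan_cot[of "pi * \<beta> * p"] ap by simp
  then have "1 - strip_cdf \<beta> v < p"
    using \<alpha> by (simp add: strip_cdf_def field_simps)
  then show ?thesis by (simp add: p_def)
qed

subsection \<open>The Stieltjes transform of the kernel\<close>

text \<open>The solutions are the odd multiples of i pi. Applied to z = -\<alpha> w, this keeps the
  poles of 1 / (1 + exp(-\<alpha> w)) out of the strip |Im w| < pi / \<alpha>.\<close>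

lemma exp_eq_minus_1_imp:
  fixes z :: complex
  assumes "exp z = -1"
  shows "pi \<le> \<bar>Im z\<bar>"
proof -
  have "exp (z - \<i> * of_real pi) = 1"
    using assms by (simp add: exp_diff)
  then obtain n :: int where n: "Im z - pi = of_int (2 * n) * pi"
    unfolding exp_eq_1 by auto
  have "Im z = of_int (2 * n + 1) * pi"
    using n by (simp add: algebra_simps)
  moreover have "1 * pi \<le> \<bar>of_int (2 * n + 1)\<bar> * pi"
  proof (intro mult_right_mono)
    have "1 \<le> \<bar>2 * n + 1\<bar>" by presburger
    then show "1 \<le> \<bar>real_of_int (2 * n + 1)\<bar>" by linarith
  qed simp
  ultimately show ?thesis
    by (simp add: abs_mult)
qed

lemma exp_eq_1_imp_0:
  fixes z :: complex
  assumes "exp z = 1" "\<bar>Im z\<bar> < 2 * pi"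
  shows "z = 0"
proof -
  obtain n :: int where n: "Re z = 0" "Im z = of_int (2 * n) * pi"
    using assms(1) unfolding exp_eq_1 by auto
  have "n = 0"
  proof (rule ccontr)
    assume "n \<noteq> 0"
    then have "2 * pi * 1 \<le> 2 * pi * \<bar>of_int n\<bar>"
      using pi_gt_zero by (intro mult_left_mono) linarith+
    then show False using assms(2) n by (simp add: abs_mult)
  qed
  with n show ?thesis by (simp add: complex_eq_iff)
qed

lemma contour_integral_linepath_horizontal:
  assumes "a < b"
  shows "contour_integral (linepath (Complex a c) (Complex b c)) f = integral {a..b} (\<lambda>x. f (Complex x c))"
proof -
  have "contour_integral (linepath (Complex a c) (Complex b c)) f =
        contour_integral (linepath (of_real a) (of_real b)) (\<lambda>w. f (w + Complex 0 c))"
  proof -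
    have "linepath (Complex a c) (Complex b c) t = linepath (of_real a) (of_real b) t + Complex 0 c" for t
      by (simp add: linepath_def complex_eq_iff algebra_simps)
    moreover have "Complex b c - Complex a c = of_real b - of_real a"
      by (simp add: complex_eq_iff)
    ultimately show ?thesis
      by (simp add: contour_integral_integral)
  qed
  also have "\<dots> = integral {a..b} (\<lambda>x. f (of_real x + Complex 0 c))"
    using assms by (subst contour_integral_linepath_Reals_eq) auto
  also have "(\<lambda>x. f (of_real x + Complex 0 c)) = (\<lambda>x. f (Complex x c))"
    by (intro ext arg_cong[of _ _ f]) (simp add: complex_eq_iff)
  finally show ?thesis .
qed

lemma exp_Complex_pi: "exp (Complex v pi - of_real y) = - of_real (exp (v - y))"
  "exp (Complex v (-pi) - of_real y) = - of_real (exp (v - y))"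
  by (simp_all add: complex_eq_iff Re_exp Im_exp)

text \<open>The kernel is the jump of 1 / (1 + exp(-\<alpha> w)) between the two long sides of the
  contour used below. The two exponentials are complex conjugates \<open>z\<close> and
  \<open>z'\<close>, and the denominators multiply to the real number \<open>d\<close>, which is 2 e
  (cosh(\<alpha> v) + cos(pi \<alpha>)).\<close>

lemma strip_kernel_boundary_jump:
  assumes "0 < \<alpha>" "\<alpha> < 1"
  shows "1 / (1 + exp (- of_real \<alpha> * Complex v pi)) - 1 / (1 + exp (- of_real \<alpha> * Complex v (-pi)))
           = 2 * of_real pi * \<i> * of_real (strip_kernel \<alpha> v)"
proof -
  define e c s where "e = exp (- \<alpha> * v)" and "c = cos (pi * \<alpha>)" and "s = sin (pi * \<alpha>)"
  define z where "z = complex_of_real e * (of_real c - \<i> * of_real s)"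
  define z' where "z' = complex_of_real e * (of_real c + \<i> * of_real s)"
  have z: "exp (- of_real \<alpha> * Complex v pi) = z" "exp (- of_real \<alpha> * Complex v (-pi)) = z'"
    by (simp_all add: complex_eq_iff Re_exp Im_exp z_def z'_def e_def c_def s_def mult.commute)
  have e: "e > 0" by (simp add: e_def)
  have cs: "c\<^sup>2 + s\<^sup>2 = 1" by (simp add: c_def s_def)
  define d where "d = 1 + 2 * e * c + e\<^sup>2"
  have ch: "cosh (\<alpha> * v) = (1 + e\<^sup>2) / (2 * e)"
    using e by (simp add: cosh_def e_def exp_minus field_simps power2_eq_square)
  have dd: "cosh (\<alpha> * v) + c = d / (2 * e)"
    using e by (simp add: ch d_def field_simps)
  have "0 < cosh (\<alpha> * v) + c"
    unfolding c_def by (rule cosh_add_cos_pos) fact+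
  then have d: "d > 0" using e dd by (simp add: zero_less_divide_iff)
  have "(1 + z) * (1 + z') = of_real (1 + 2 * e * c + e\<^sup>2 * (c\<^sup>2 + s\<^sup>2))"
    by (simp add: z_def z'_def complex_eq_iff algebra_simps power2_eq_square)
  then have p: "(1 + z) * (1 + z') = of_real d"
    unfolding cs d_def by simp
  then have "1 + z \<noteq> 0" "1 + z' \<noteq> 0" using d by auto
  then have "1 / (1 + z) - 1 / (1 + z') = (z' - z) / ((1 + z) * (1 + z'))"
    by (simp add: field_simps)
  also have "z' - z = \<i> * of_real (2 * e * s)"
    by (simp add: z_def z'_def algebra_simps)
  also have "\<i> * of_real (2 * e * s) / ((1 + z) * (1 + z')) = \<i> * of_real (2 * e * s / d)"
    unfolding p by simp
  also have "2 * e * s / d = 2 * pi * strip_kernel \<alpha> v"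
    unfolding strip_kernel_def c_def[symmetric] s_def[symmetric] dd using d e by (simp add: field_simps)
  finally show ?thesis unfolding z by simp
qed

text \<open>Residue theorem for \<open>1 / ((1 + exp (- \<alpha> w)) (exp (w - y) - 1))\<close> on the rectangle with
  vertices \<open>\<plusminus> R \<plusminus> i \<pi>\<close>, in which the only pole is \<open>w = y\<close>.\<close>

lemma strip_contour_bound:
  fixes \<alpha> y R :: real
  assumes \<alpha>: "0 < \<alpha>" "\<alpha> < 1" and R: "0 < R" "\<bar>y\<bar> < R"
  shows "\<bar>1 / (1 + exp (- \<alpha> * y)) - integral {-R..R} (\<lambda>v. strip_kernel \<alpha> v / (1 + exp (v - y)))\<bar>
          \<le> 1 / ((1 - exp (- \<alpha> * R)) * (exp (R - y) - 1)) + 1 / ((exp (\<alpha> * R) - 1) * (1 - exp (- R - y)))"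
proof -
  define P :: "complex \<Rightarrow> complex" where "P w = 1 / (1 + exp (- of_real \<alpha> * w))" for w
  define Q :: "complex \<Rightarrow> complex" where "Q w = exp (w - of_real y) - 1" for w
  define f where "f w = P w / Q w" for w
  \<comment> \<open>Poles of \<open>P\<close> satisfy |Im w| \<ge> pi / \<alpha>, and the zeros of
    \<open>Q\<close> are y + 2 pi i n. As \<alpha> < 1, both distances exceed pi, so the convex
    strip \<open>S\<close> contains the closed rectangle but only the pole y.\<close>
  define m where "m = min (pi / \<alpha>) (2 * pi)"
  define S where "S = {w. Im w < m} \<inter> {w. - m < Im w}"
  have m: "pi < m" using \<alpha> by (simp add: m_def field_simps)
  have S: "open S" "convex S"
    unfolding S_def by (intro open_Int convex_Int open_halfspace_Im_lt open_halfspace_Im_gt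
      convex_halfspace_Im_lt convex_halfspace_Im_gt)+
  then have conn: "connected S" by (intro convex_connected)
  have nz: "1 + exp (- of_real \<alpha> * w) \<noteq> 0" if "w \<in> S" for w
  proof
    assume "1 + exp (- of_real \<alpha> * w) = 0"
    then have "exp (- of_real \<alpha> * w) = -1" by (simp add: eq_neg_iff_add_eq_0 add.commute)
    from exp_eq_minus_1_imp[OF this] have "pi \<le> \<alpha> * \<bar>Im w\<bar>"
      using \<alpha> by (simp add: abs_mult)
    moreover have "\<bar>Im w\<bar> < pi / \<alpha>" using that by (auto simp: S_def m_def)
    ultimately show False using \<alpha> by (simp add: field_simps)
  qed
  have Q0: "Q w = 0 \<Longrightarrow> w = of_real y" if "w \<in> S" for w
    using exp_eq_1_imp_0[of "w - of_real y"] that by (auto simp: Q_def S_def m_def)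
  have P: "P holomorphic_on S"
    unfolding P_def[abs_def] using nz by (intro holomorphic_intros) auto
  have Q: "Q holomorphic_on S" unfolding Q_def[abs_def] by (intro holomorphic_intros)
  have hol: "f holomorphic_on S - {of_real y}"
    unfolding f_def[abs_def] using Q0
    by (intro holomorphic_on_divide holomorphic_on_subset[OF P] holomorphic_on_subset[OF Q]) auto
  have yS: "of_real y \<in> S" using m by (simp add: S_def) (meson less_trans pi_gt_zero)
  \<comment> \<open>The zero of \<open>Q\<close> at y is simple with derivative 1, so the residue is
    the value of \<open>P\<close>, which is the claimed value of the integral over the whole
    line.\<close>
  have res: "residue f (of_real y) = P (of_real y)"
  proof -
    have "residue (\<lambda>w. P w / Q w) (of_real y) = P (of_real y) / 1"
    proof (rule residue_simple_pole_deriv[OF P Q S(1) conn yS])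
      show "(Q has_field_derivative 1) (at (of_real y))"
        unfolding Q_def by (auto intro!: derivative_eq_intros)
      show "P (of_real y) \<noteq> 0" using nz[OF yS] by (simp add: P_def)
    qed (simp_all add: Q_def)
    then show ?thesis by (simp add: f_def[abs_def])
  qed
  define a b c d where "a = Complex (-R) (-pi)" and "b = Complex R (-pi)"
    and "c = Complex R pi" and "d = Complex (-R) pi"
  have cbox: "cbox a c \<subseteq> S" using m by (auto simp: S_def a_def c_def in_cbox_complex_iff)
  have ybox: "of_real y \<in> box a c" using R by (auto simp: a_def c_def in_box_complex_iff)
  have img: "path_image (rectpath a c) \<subseteq> S - {of_real y}"
    using cbox ybox path_image_rectpath_cbox_minus_box[of a c] R by (auto simp: a_def c_def)
  have "contour_integral (rectpath a c) f = 2 * pi * \<i> * (\<Sum>p\<in>{of_real y}. winding_number (rectpath a c) p * residue f p)"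
  proof (rule Residue_theorem[OF S(1) conn _ hol _ _ img])
    show "\<forall>z. z \<notin> S \<longrightarrow> winding_number (rectpath a c) z = 0"
      using cbox R by (intro allI impI winding_number_rectpath_outside) (auto simp: a_def c_def)
  qed auto
  moreover have "winding_number (rectpath a c) (of_real y) = 1"
    by (rule winding_number_rectpath) fact
  ultimately have total: "contour_integral (rectpath a c) f = 2 * pi * \<i> * P (of_real y)"
    by (simp add: res)
  have rp: "rectpath a c = linepath a b +++ linepath b c +++ linepath c d +++ linepath d a"
    by (simp add: rectpath_def Let_def a_def b_def c_def d_def)
  have segs: "closed_segment a b \<subseteq> S - {of_real y}" "closed_segment b c \<subseteq> S - {of_real y}"
     "closed_segment c d \<subseteq> S - {of_real y}" "closed_segment d a \<subseteq> S - {of_real y}"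
    using img unfolding rp by (auto simp: path_image_join)
  have cont: "continuous_on (S - {of_real y}) f"
    by (rule holomorphic_on_imp_continuous_on[OF hol])
  have int: "f contour_integrable_on linepath a b" "f contour_integrable_on linepath b c"
    "f contour_integrable_on linepath c d" "f contour_integrable_on linepath d a"
    using segs by (auto intro!: contour_integrable_continuous_linepath continuous_on_subset[OF cont])
  have sum: "contour_integral (rectpath a c) f = contour_integral (linepath a b) f +
     (contour_integral (linepath b c) f + (contour_integral (linepath c d) f + contour_integral (linepath d a) f))"
    unfolding rp using int by (simp add: contour_integrable_join)
  have cd: "contour_integral (linepath c d) f = - contour_integral (linepath d c) f"
    by (rule contour_integral_reverse_linepath)
       (use segs in \<open>auto intro!: continuous_on_subset[OF cont] simp: closed_segment_commute\<close>)
  have int': "(\<lambda>v. f (Complex v (-pi))) integrable_on {-R..R}" "(\<lambda>v. f (Complex v pi)) integrable_on {-R..R}"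
    using m pi_gt_zero by (auto intro!: integrable_continuous_interval continuous_on_compose2[OF cont]
      continuous_intros simp: S_def complex_eq_iff simp del: pi_gt_zero)
  \<comment> \<open>On both horizontal sides exp(w - y) equals -exp(v - y), so \<open>Q\<close>
    takes the same value on them and only the jump of \<open>P\<close> remains. The upper side runs
    backwards, hence the difference.\<close>
  have "contour_integral (linepath a b) f + contour_integral (linepath c d) f
      = integral {-R..R} (\<lambda>v. f (Complex v (-pi)) - f (Complex v pi))"
    unfolding cd using R int' unfolding a_def b_def c_def d_def
    by (simp add: contour_integral_linepath_horizontal integral_diff)
  also have "(\<lambda>v. f (Complex v (-pi)) - f (Complex v pi))
      = (\<lambda>v. 2 * of_real pi * \<i> * of_real (strip_kernel \<alpha> v / (1 + exp (v - y))))"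
  proof
    fix v
    have pos: "complex_of_real (1 + exp (v - y)) \<noteq> 0"
      by (metis add_pos_pos exp_gt_zero less_irrefl of_real_eq_0_iff zero_less_one)
    have "f (Complex v (-pi)) - f (Complex v pi)
        = (P (Complex v pi) - P (Complex v (-pi))) / of_real (1 + exp (v - y))"
    proof -
      have "Q (Complex v pi) = - of_real (1 + exp (v - y))" "Q (Complex v (-pi)) = - of_real (1 + exp (v - y))"
        unfolding Q_def exp_Complex_pi by simp_all
      then show ?thesis
        by (simp only: f_def minus_divide_right[symmetric] diff_divide_distrib) simp
    qed
    also have "P (Complex v pi) - P (Complex v (-pi)) = 2 * of_real pi * \<i> * of_real (strip_kernel \<alpha> v)"
      unfolding P_def by (rule strip_kernel_boundary_jump) fact+
    finally show "f (Complex v (-pi)) - f (Complex v pi)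
      = 2 * of_real pi * \<i> * of_real (strip_kernel \<alpha> v / (1 + exp (v - y)))" by simp
  qed
  also have "integral {-R..R} \<dots> = 2 * of_real pi * \<i> *
      of_real (integral {-R..R} (\<lambda>v. strip_kernel \<alpha> v / (1 + exp (v - y))))"
  proof -
    have "continuous_on {-R..R} (\<lambda>v. strip_kernel \<alpha> v / (1 + exp (v - y)))"
      by (intro continuous_intros continuous_on_strip_kernel \<alpha>)
         (metis add_pos_pos exp_gt_zero less_irrefl zero_less_one)
    then have "(\<lambda>v. strip_kernel \<alpha> v / (1 + exp (v - y))) integrable_on {-R..R}"
      by (rule integrable_continuous_interval)
    from has_integral_mult_right[OF has_integral_of_real[OF integrable_integral[OF this]]]
    show ?thesis by (intro integral_unique)
  qed
  finally have horiz: "contour_integral (linepath a b) f + contour_integral (linepath c d) f = \<dots>" .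
  \<comment> \<open>On the right side \<open>P\<close> stays bounded and 1 / \<open>Q\<close> decays
    like exp(-R).\<close>
  have bc: "norm (contour_integral (linepath b c) f) \<le>
      1 / ((1 - exp (- \<alpha> * R)) * (exp (R - y) - 1)) * norm (c - b)"
  proof (rule contour_integral_bound_linepath[OF int(2)])
    have e: "0 < 1 - exp (- \<alpha> * R)" "0 < exp (R - y) - 1" using \<alpha> R by auto
    then show "0 \<le> 1 / ((1 - exp (- \<alpha> * R)) * (exp (R - y) - 1))" by simp
    fix w assume "w \<in> closed_segment b c"
    then have w: "Re w = R" using R by (auto simp: b_def c_def closed_segment_same_Re)
    have "1 - exp (- \<alpha> * R) \<le> norm (1 + exp (- of_real \<alpha> * w))"
      using norm_diff_ineq[of 1 "exp (- of_real \<alpha> * w)"] w by simp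
    moreover have "exp (R - y) - 1 \<le> norm (Q w)"
      using norm_triangle_ineq2[of "exp (w - of_real y)" 1] w by (simp add: Q_def)
    ultimately have "(1 - exp (- \<alpha> * R)) * (exp (R - y) - 1) \<le> norm ((1 + exp (- of_real \<alpha> * w)) * Q w)"
      unfolding norm_mult using e by (intro mult_mono) auto
    then have "1 / norm ((1 + exp (- of_real \<alpha> * w)) * Q w) \<le> 1 / ((1 - exp (- \<alpha> * R)) * (exp (R - y) - 1))"
      by (intro frac_le mult_pos_pos[OF e]) auto
    then show "norm (f w) \<le> 1 / ((1 - exp (- \<alpha> * R)) * (exp (R - y) - 1))"
      by (simp add: f_def P_def norm_divide norm_mult)
  qed
  \<comment> \<open>On the left side the roles are exchanged: 1 / \<open>Q\<close> stays bounded,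
    and \<open>P\<close> decays like exp(-\<alpha> R).\<close>
  have da: "norm (contour_integral (linepath d a) f) \<le>
      1 / ((exp (\<alpha> * R) - 1) * (1 - exp (- R - y))) * norm (a - d)"
  proof (rule contour_integral_bound_linepath[OF int(4)])
    have e: "0 < exp (\<alpha> * R) - 1" "0 < 1 - exp (- R - y)" using \<alpha> R by auto
    then show "0 \<le> 1 / ((exp (\<alpha> * R) - 1) * (1 - exp (- R - y)))" by simp
    fix w assume "w \<in> closed_segment d a"
    then have w: "Re w = -R" using R by (auto simp: a_def d_def closed_segment_same_Re)
    have "exp (\<alpha> * R) - 1 \<le> norm (1 + exp (- of_real \<alpha> * w))"
      using norm_diff_ineq[of "exp (- of_real \<alpha> * w)" 1] w by (simp add: add.commute)
    moreover have "1 - exp (- R - y) \<le> norm (Q w)"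
      using norm_triangle_ineq2[of 1 "exp (w - of_real y)"] w by (simp add: Q_def norm_minus_commute)
    ultimately have "(exp (\<alpha> * R) - 1) * (1 - exp (- R - y)) \<le> norm ((1 + exp (- of_real \<alpha> * w)) * Q w)"
      unfolding norm_mult using e by (intro mult_mono) auto
    then have "1 / norm ((1 + exp (- of_real \<alpha> * w)) * Q w) \<le> 1 / ((exp (\<alpha> * R) - 1) * (1 - exp (- R - y)))"
      by (intro frac_le mult_pos_pos[OF e]) auto
    then show "norm (f w) \<le> 1 / ((exp (\<alpha> * R) - 1) * (1 - exp (- R - y)))"
      by (simp add: f_def P_def norm_divide norm_mult)
  qed
  \<comment> \<open>Each vertical side has length 2 pi, which cancels against the factor 2 pi i of
    the residue theorem.\<close>
  have len: "norm (c - b) = 2 * pi" "norm (a - d) = 2 * pi"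
    by (simp_all add: a_def b_def c_def d_def cmod_def real_sqrt_mult)
  let ?D = "1 / (1 + exp (- \<alpha> * y)) - integral {-R..R} (\<lambda>v. strip_kernel \<alpha> v / (1 + exp (v - y)))"
  have Py: "P (of_real y) = of_real (1 / (1 + exp (- \<alpha> * y)))"
    by (simp add: P_def flip: exp_of_real)
  have "2 * of_real pi * \<i> * of_real ?D
      = contour_integral (rectpath a c) f - (contour_integral (linepath a b) f + contour_integral (linepath c d) f)"
    unfolding total horiz Py by (simp add: right_diff_distrib)
  also have "\<dots> = contour_integral (linepath b c) f + contour_integral (linepath d a) f"
    unfolding sum by simp
  finally have "2 * of_real pi * \<i> * of_real ?D = contour_integral (linepath b c) f + contour_integral (linepath d a) f" .
  then have "norm (2 * of_real pi * \<i> * of_real ?D :: complex) \<le>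
    1 / ((1 - exp (- \<alpha> * R)) * (exp (R - y) - 1)) * (2 * pi) + 1 / ((exp (\<alpha> * R) - 1) * (1 - exp (- R - y))) * (2 * pi)"
    using norm_triangle_le[OF add_mono[OF bc da]] len by simp
  then have "2 * pi * \<bar>?D\<bar> \<le> 2 * pi * (1 / ((1 - exp (- \<alpha> * R)) * (exp (R - y) - 1)) + 1 / ((exp (\<alpha> * R) - 1) * (1 - exp (- R - y))))"
    by (simp only: norm_mult norm_of_real) (simp add: algebra_simps)
  then show ?thesis by simp
qed

text \<open>Let R tend to infinity in \<open>strip_contour_bound\<close>. For y = ln s the weight 1
  / (1 + exp(v - y)) is s / (s + exp v), the form in which it arises when the Laplace transform of
  the kernel representation is computed.\<close>

lemma strip_kernel_stieltjes:
  assumes \<alpha>: "0 < \<alpha>" "\<alpha> < 1"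
  shows "integrable lborel (\<lambda>v. strip_kernel \<alpha> v / (1 + exp (v - y)))"
    and "(LINT v|lborel. strip_kernel \<alpha> v / (1 + exp (v - y))) = 1 / (1 + exp (- \<alpha> * y))"
proof -
  let ?g = "\<lambda>v. strip_kernel \<alpha> v / (1 + exp (v - y))"
  have cont: "continuous_on T ?g" for T
    by (intro continuous_intros continuous_on_strip_kernel \<alpha>) (metis add_pos_pos exp_gt_zero less_irrefl zero_less_one)
  note [measurable] = borel_measurable_strip_kernel[OF \<alpha>]
  show int: "integrable lborel ?g"
  proof (rule Bochner_Integration.integrable_bound[OF strip_kernel_integrable[OF \<alpha>]])
    show "AE v in lborel. norm (?g v) \<le> norm (strip_kernel \<alpha> v)"
      using strip_kernel_pos[OF \<alpha>]
      by (intro AE_I2) (simp add: divide_le_eq add_pos_pos abs_of_pos mult_le_cancel_left1 order_less_imp_le not_less)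
  qed simp
  define I where "I n = integral {-real n..real n} ?g" for n :: nat
  have "(\<lambda>n. LINT v|lborel. indicator {-real n..real n} v *\<^sub>R ?g v) \<longlonglongrightarrow> (LINT v|lborel. ?g v)"
  proof (rule integral_dominated_convergence[where w="\<lambda>v. norm (?g v)"])
    show "AE v in lborel. (\<lambda>n. indicator {-real n..real n} v *\<^sub>R ?g v) \<longlonglongrightarrow> ?g v"
    proof (intro AE_I2 tendsto_eventually)
      fix v :: real
      show "\<forall>\<^sub>F n in sequentially. indicator {-real n..real n} v *\<^sub>R ?g v = ?g v"
        using eventually_ge_at_top[of "nat \<lceil>\<bar>v\<bar>\<rceil>"] by eventually_elim (auto simp: indicator_def)
    qed
    show "AE v in lborel. norm (indicator {-real n..real n} v *\<^sub>R ?g v) \<le> norm (?g v)" for n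
      by (intro AE_I2) (simp add: indicator_def)
  qed (use integrable_norm[OF int] in simp_all)
  also have "(\<lambda>n. LINT v|lborel. indicator {-real n..real n} v *\<^sub>R ?g v) = I"
    unfolding I_def using set_borel_integral_eq_integral(2)[of _ ?g] borel_integrable_atLeastAtMost'[OF cont]
    by (auto simp: set_lebesgue_integral_def)
  finally have lim1: "I \<longlonglongrightarrow> (LINT v|lborel. ?g v)" .
  have lim2: "(\<lambda>n. 1 / (1 + exp (- \<alpha> * y)) - I n) \<longlonglongrightarrow> 0"
  proof (rule Lim_null_comparison)
    show "\<forall>\<^sub>F n in sequentially. norm (1 / (1 + exp (- \<alpha> * y)) - I n) \<le>
       1 / ((1 - exp (- \<alpha> * real n)) * (exp (real n - y) - 1)) + 1 / ((exp (\<alpha> * real n) - 1) * (1 - exp (- real n - y)))"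
      using eventually_gt_at_top[of "nat \<lceil>\<bar>y\<bar>\<rceil>"]
    proof eventually_elim
      case (elim n)
      then have "0 < real n" "\<bar>y\<bar> < real n" by linarith+
      from strip_contour_bound[OF \<alpha> this] show ?case by (simp add: I_def)
    qed
    show "(\<lambda>n. 1 / ((1 - exp (- \<alpha> * real n)) * (exp (real n - y) - 1)) + 1 / ((exp (\<alpha> * real n) - 1) * (1 - exp (- real n - y))))
       \<longlonglongrightarrow> 0"
      using \<alpha> by real_asymp
  qed
  then have "I \<longlonglongrightarrow> 1 / (1 + exp (- \<alpha> * y))"
    using tendsto_diff[OF tendsto_const[of "1 / (1 + exp (- \<alpha> * y))"] lim2] by simp
  with lim1 show "(LINT v|lborel. ?g v) = 1 / (1 + exp (- \<alpha> * y))"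
    by (rule LIMSEQ_unique)
qed

subsection \<open>Injectivity of the Laplace transform\<close>

lemma has_bochner_integral_powr_exp:
  fixes a s :: real
  assumes "0 < a" "0 < s"
  shows "has_bochner_integral lborel (\<lambda>x. indicator {0<..} x * (x powr (a - 1) * exp (- s * x)))
           (Gamma a / s powr a)"
proof (rule has_bochner_integral_nn_integral)
  let ?f = "\<lambda>x::real. indicator {0<..} x * (x powr (a - 1) * exp (- s * x))"
  have "ennreal (Gamma a) = (\<integral>\<^sup>+t. ennreal (indicator {0..} t * t powr (a - 1) / exp t) \<partial>lborel)"
    by (rule Gamma_conv_nn_integral_real) fact
  also have "\<dots> = \<bar>s\<bar> * (\<integral>\<^sup>+t. ennreal (indicator {0..} (0 + s * t) * (0 + s * t) powr (a - 1) / exp (0 + s * t)) \<partial>lborel)"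
    using assms by (intro nn_integral_real_affine) auto
  also have "\<dots> = s * (\<integral>\<^sup>+t. ennreal (s powr (a - 1)) * ennreal (?f t) \<partial>lborel)"
    using assms
    by (intro arg_cong2[of _ _ _ _ "(*)"] nn_integral_cong)
       (auto simp: indicator_def powr_mult exp_minus divide_inverse zero_le_mult_iff simp flip: ennreal_mult)
  also have "\<dots> = ennreal (s powr a) * (\<integral>\<^sup>+t. ennreal (?f t) \<partial>lborel)"
    using assms by (subst nn_integral_cmult)
      (auto simp: mult.assoc[symmetric] powr_diff simp flip: ennreal_mult)
  finally have "ennreal (Gamma a) = ennreal (s powr a) * (\<integral>\<^sup>+t. ennreal (?f t) \<partial>lborel)" .
  then have "ennreal (1 / s powr a) * ennreal (Gamma a)
      = ennreal (1 / s powr a) * (ennreal (s powr a) * (\<integral>\<^sup>+t. ennreal (?f t) \<partial>lborel))"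
    by simp
  also have "\<dots> = (\<integral>\<^sup>+t. ennreal (?f t) \<partial>lborel)"
    using assms by (simp add: mult.assoc[symmetric] flip: ennreal_mult)
  finally show "(\<integral>\<^sup>+t. ennreal (?f t) \<partial>lborel) = ennreal (Gamma a / s powr a)"
    using assms Gamma_real_pos[of a] by (simp flip: ennreal_mult)
qed (use assms Gamma_real_pos[of a] in \<open>auto simp: indicator_def\<close>)

lemma has_bochner_integral_exp_neg:
  fixes s :: real
  assumes "0 < s"
  shows "has_bochner_integral lborel (\<lambda>x. indicator {0<..} x * exp (- s * x)) (1 / s)"
proof -
  have "(\<lambda>x::real. indicator {0<..} x * (x powr (1 - 1) * exp (- s * x))) = (\<lambda>x. indicator {0<..} x * exp (- s * x))"
    by (auto simp: indicator_def fun_eq_iff)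
  then show ?thesis
    using has_bochner_integral_powr_exp[of 1 s] assms by simp
qed

lemma continuous_AE_zero_imp_zero:
  fixes f :: "real \<Rightarrow> real"
  assumes "continuous_on {0..} f" and "AE x in lborel. 0 < x \<longrightarrow> f x = 0" and "0 \<le> x"
  shows "f x = 0"
proof (rule ccontr)
  assume "f x \<noteq> 0"
  then obtain d where d: "d > 0" "\<And>y. y \<ge> 0 \<Longrightarrow> dist y x < d \<Longrightarrow> dist (f y) (f x) < \<bar>f x\<bar>"
    using assms(1,3) unfolding continuous_on_iff by (metis atLeast_iff zero_less_abs_iff)
  have "AE y in lborel. y \<notin> {x<..<x + d}"
    using assms(2)
  proof eventually_elim
    case (elim y)
    show ?case
    proof
      assume y: "y \<in> {x<..<x + d}"
      then have "dist (f y) (f x) < \<bar>f x\<bar>"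
        using assms(3) by (intro d(2)) (auto simp: dist_real_def)
      with elim y assms(3) show False by (auto simp: dist_real_def)
    qed
  qed
  then have "{x<..<x + d} \<in> null_sets lborel"
    by (subst AE_iff_null_sets) auto
  then show False using d(1) by (simp add: null_sets_def)
qed

text \<open>Lerch's argument. Under u = exp(-x) the values s = c + 1 + n become moments, so the
  weighted function \<open>G\<close> is orthogonal to all polynomials in exp(-x). Approximating by
  such polynomials makes the integral of the square of \<open>G\<close> arbitrarily small.\<close>

lemma laplace_transform_eq_zero_imp:
  fixes g :: "real \<Rightarrow> real"
  assumes cont: "continuous_on {0..} g"
    and bound: "\<And>x. 0 \<le> x \<Longrightarrow> \<bar>g x\<bar> \<le> C * exp (c * x)"
    and zero: "\<And>s. c < s \<Longrightarrow> (LINT x|lborel. indicator {0<..} x * (exp (- s * x) * g x)) = 0"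
    and "0 \<le> x"
  shows "g x = 0"
proof -
  \<comment> \<open>The extra factor exp(-x) beyond the growth rate c makes \<open>G\<close> decay
    like exp(-x). Hence \<open>w\<close>, which is \<open>G\<close> in the variable u = exp(-x),
    tends to 0 as u tends to 0; since \<open>0 powr (c + 1) = 0\<close>, it is continuous on the
    closed interval, as Weierstrass approximation requires.\<close>
  define G where "G x = exp (- (c + 1) * x) * g x" for x
  define w where "w u = u powr (c + 1) * g (- ln u)" for u
  have C: "0 \<le> C" using bound[of 0] by simp
  have Gcont: "continuous_on {0..} G"
    unfolding G_def[abs_def] by (intro continuous_intros cont)
  have Gb: "\<bar>G x\<bar> \<le> C * exp (- x)" if "0 \<le> x" for x
  proof -
    have "\<bar>G x\<bar> \<le> exp (- (c + 1) * x) * (C * exp (c * x))"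
      unfolding G_def abs_mult using bound[OF that] by (intro mult_mono) auto
    also have "\<dots> = C * exp (- x)" by (simp add: algebra_simps flip: exp_add)
    finally show ?thesis .
  qed
  have wG: "w (exp (- x)) = G x" for x
    by (simp add: w_def G_def powr_def algebra_simps)
  have wcont: "continuous_on {0..1} w"
    unfolding continuous_on_eq_continuous_within
  proof
    fix u :: real assume u: "u \<in> {0..1}"
    show "continuous (at u within {0..1}) w"
    proof (cases "u = 0")
      case False
      have "continuous_on {0<..1} w"
        unfolding w_def[abs_def]
        by (intro continuous_intros continuous_on_compose2[OF cont]) (auto simp: ln_le_zero_iff)
      then have "continuous (at u within {0<..1}) w"
        using u False by (auto simp: continuous_on_eq_continuous_within)
      moreover have "at u within {0<..1} = at u within {0..1}"
        using u False by (intro at_within_nhd[of _ "{0<..}"]) auto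
      ultimately show ?thesis by simp
    next
      case True
      have "(w \<longlongrightarrow> 0) (at 0 within {0..1})"
      proof (rule Lim_null_comparison)
        show "\<forall>\<^sub>F u in at 0 within {0..1}. norm (w u) \<le> C * u"
          unfolding eventually_at_filter
        proof (intro always_eventually allI impI)
          fix u :: real assume "u \<noteq> 0" "u \<in> {0..1}"
          then have "0 < u" "u \<le> 1" by auto
          then show "norm (w u) \<le> C * u"
            using Gb[of "- ln u"] wG[of "- ln u"] by (simp add: ln_le_zero_iff)
        qed
        show "((\<lambda>u. C * u) \<longlongrightarrow> 0) (at 0 within {0..1})"
          by (auto intro!: tendsto_eq_intros)
      qed
      then show ?thesis using True by (simp add: continuous_within w_def)
    qed
  qed
  have Gm [measurable]: "(\<lambda>x. indicator {0<..} x * G x) \<in> borel_measurable borel"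
  proof -
    have "(\<lambda>x. indicator {0<..} x *\<^sub>R G x) \<in> borel_measurable borel"
      by (rule borel_measurable_continuous_on_indicator)
         (auto intro: continuous_on_subset[OF Gcont])
    then show ?thesis by simp
  qed
  have ie: "integrable lborel (\<lambda>x. indicat_real {0<..} x * exp (- 1 * x))"
    and ie': "(LINT x|lborel. indicat_real {0<..} x * exp (- 1 * x)) = 1"
    using has_bochner_integral_exp_neg[of 1] by (simp_all add: has_bochner_integral_iff)
  have iG: "integrable lborel (\<lambda>x. indicator {0<..} x * (h x * G x))"
    if [measurable]: "h \<in> borel_measurable borel" and h: "\<And>x. 0 < x \<Longrightarrow> \<bar>h x\<bar> \<le> B" for h B
  proof (rule Bochner_Integration.integrable_bound)
    show "integrable lborel (\<lambda>x. (B * C) * (indicator {0<..} x * exp (- 1 * x)))"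
      by (intro integrable_mult_right ie)
    have "(\<lambda>x. h x * (indicator {0<..} x * G x)) \<in> borel_measurable borel" by measurable
    then show "(\<lambda>x. indicator {0<..} x * (h x * G x)) \<in> borel_measurable lborel"
      by (simp add: mult.left_commute)
    show "AE x in lborel. norm (indicator {0<..} x * (h x * G x))
        \<le> norm (B * C * (indicator {0<..} x * exp (- 1 * x)))"
    proof (intro AE_I2)
      fix x :: real
      have B: "0 \<le> B" using h[of 1] by simp
      have "0 < x \<Longrightarrow> \<bar>h x\<bar> * \<bar>G x\<bar> \<le> B * (C * exp (- x))"
        using h[of x] Gb[of x] B by (intro mult_mono) auto
      then show "norm (indicator {0<..} x * (h x * G x))
        \<le> norm (B * C * (indicator {0<..} x * exp (- 1 * x)))"
        using B C by (auto simp: indicator_def abs_mult)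
    qed
  qed
  have moment: "(LINT x|lborel. indicator {0<..} x * (exp (- x) ^ n * G x)) = 0" for n
  proof -
    have "exp (- x) ^ n * G x = exp (- (c + 1 + real n) * x) * g x" for x
      by (simp add: G_def algebra_simps flip: exp_add exp_of_nat_mult)
    then show ?thesis using zero[of "c + 1 + real n"] by simp
  qed
  define I where "I = (LINT x|lborel. indicator {0<..} x * (G x * G x))"
  have iGG: "integrable lborel (\<lambda>x. indicator {0<..} x * (G x * G x))"
  proof -
    \<comment> \<open>\<open>iG\<close> asks for a factor \<open>h\<close> that is measurable on the
      whole line, while \<open>G\<close> is controlled only on the half line; the additional
      indicator repairs this and leaves the product unchanged.\<close>
    have "integrable lborel (\<lambda>x. indicator {0<..} x * ((indicator {0<..} x * G x) * G x))"
    proof (rule iG[where B=C])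
      fix x :: real assume "0 < x"
      then show "\<bar>indicator {0<..} x * G x\<bar> \<le> C"
        using Gb[of x] mult_left_mono[of "exp (-x)" 1 C] C by (auto simp: indicator_def)
    qed measurable
    also have "(\<lambda>x. indicator {0<..} x * ((indicator {0<..} x * G x) * G x)) = (\<lambda>x. indicator {0<..} x * (G x * G x))"
      by (auto simp: indicator_def)
    finally show ?thesis .
  qed
  have small: "I \<le> e * C" if e: "e > 0" for e
  proof -
    obtain p where p: "real_polynomial_function p" "\<And>u. u \<in> {0..1} \<Longrightarrow> \<bar>w u - p u\<bar> < e"
      using Stone_Weierstrass_real_polynomial_function[OF compact_Icc wcont e] by blast
    obtain a n where pa: "p = (\<lambda>x. \<Sum>i\<le>n. a i * x ^ i)"
      using p(1) real_polynomial_function_iff_sum by blast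
    have terms: "integrable lborel (\<lambda>x. indicator {0<..} x * (exp (- x) ^ i * G x))" for i
      by (rule iG[where B=1]) (auto intro: power_le_one)
    have ip: "integrable lborel (\<lambda>x. \<Sum>i\<le>n. a i * (indicator {0<..} x * (exp (- x) ^ i * G x)))"
      by (intro Bochner_Integration.integrable_sum integrable_mult_right terms)
    have i0: "(LINT x|lborel. (\<Sum>i\<le>n. a i * (indicator {0<..} x * (exp (- x) ^ i * G x)))) = 0"
      using terms by (subst Bochner_Integration.integral_sum) (auto simp: moment)
    have eq: "(\<Sum>i\<le>n. a i * (indicator {0<..} x * (exp (- x) ^ i * G x))) = indicator {0<..} x * (p (exp (- x)) * G x)" for x
      by (simp add: pa sum_distrib_left sum_distrib_right algebra_simps)
    \<comment> \<open>All moments vanish, so subtracting the polynomial part does not change the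
      integral, and one factor \<open>G\<close> is replaced by the small error
      \<open>w - p\<close>.\<close>
    have "I = (LINT x|lborel. indicator {0<..} x * (G x * G x) - indicator {0<..} x * (p (exp (- x)) * G x))"
      using ip i0 unfolding eq I_def by (subst Bochner_Integration.integral_diff) (auto intro: iGG)
    also have "\<dots> \<le> (LINT x|lborel. (e * C) * (indicator {0<..} x * exp (- 1 * x)))"
    proof (rule integral_mono)
      fix x :: real
      show "indicator {0<..} x * (G x * G x) - indicator {0<..} x * (p (exp (- x)) * G x)
          \<le> (e * C) * (indicator {0<..} x * exp (- 1 * x))"
      proof (cases "0 < x")
        case True
        have "(w (exp (- x)) - p (exp (- x))) * G x \<le> \<bar>w (exp (- x)) - p (exp (- x))\<bar> * \<bar>G x\<bar>"
          by (metis abs_ge_self abs_mult)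
        also have "\<dots> \<le> e * (C * exp (- x))"
          using p(2)[of "exp (- x)"] Gb[of x] True e by (intro mult_mono) auto
        finally show ?thesis using True by (simp add: wG algebra_simps)
      qed auto
    qed (use iGG ip ie in \<open>auto simp: eq\<close>)
    also have "\<dots> = e * C" using ie' by simp
    finally show ?thesis .
  qed
  have "I \<le> 0"
  proof (rule field_le_epsilon)
    fix e :: real assume e: "e > 0"
    have "I \<le> e / (C + 1) * C" using e C by (intro small) auto
    also have "\<dots> \<le> e" using e C by (simp add: field_simps)
    finally show "I \<le> 0 + e" by simp
  qed
  moreover have nn: "0 \<le> indicator {0<..} x * (G x * G x)" for x
    by (simp add: indicator_def)
  then have "0 \<le> I" unfolding I_def by (intro integral_nonneg_AE AE_I2)
  ultimately have "I = 0" by simp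
  then have "AE x in lborel. indicator {0<..} x * (G x * G x) = 0"
    using integral_nonneg_eq_0_iff_AE[OF iGG] nn unfolding I_def by auto
  then have "AE x in lborel. 0 < x \<longrightarrow> G x = 0"
    by eventually_elim (auto simp: indicator_def)
  from continuous_AE_zero_imp_zero[OF Gcont this \<open>0 \<le> x\<close>] show ?thesis
    by (simp add: G_def)
qed

subsection \<open>Mittag-Leffler functions as Laplace transforms\<close>

text \<open>In the integral for Gamma(c + 1) only the tail t \<ge> e r is kept, where t^c \<ge> (e
  r)^c. The resulting factor exp(c) absorbs the c in Gamma(c + 1) = c Gamma(c). Since r is free, the
  Gamma values in the series outgrow every geometric sequence.\<close>

lemma Gamma_ge_powr:
  fixes c r :: real
  assumes "0 < c" "0 < r"
  shows "exp (- (exp 1 * r)) * r powr c \<le> Gamma c"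
proof -
  define R where "R = exp 1 * r"
  have R: "R > 0" using assms by (simp add: R_def)
  have "((\<lambda>t. R powr c * exp (- 1 * t)) has_integral R powr c * (exp (- 1 * R) / 1)) {R..}"
    by (intro has_integral_mult_right has_integral_exp_minus_to_infinity) simp
  then have 1: "((\<lambda>t. if t \<in> {R..} then R powr c * exp (- 1 * t) else 0) has_integral R powr c * (exp (- 1 * R) / 1)) {0..}"
    using R by (subst has_integral_restrict) auto
  have 2: "((\<lambda>t. t powr (c + 1 - 1) / exp t) has_integral Gamma (c + 1)) {0..}"
    using assms by (intro Gamma_integral_real) simp
  have "R powr c * exp (- R) \<le> Gamma (c + 1)"
    using has_integral_le[OF 1 2] assms R
    by (simp add: exp_minus divide_inverse powr_mono2)
  also have "Gamma (c + 1) = c * Gamma c"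
    using assms by (intro Gamma_plus1) (auto elim!: nonpos_Ints_cases)
  also have "\<dots> \<le> exp c * Gamma c"
    using assms Gamma_real_pos[of c] exp_ge_add_one_self[of c] by (intro mult_right_mono) linarith+
  also have "R powr c = exp c * r powr c"
    using assms by (simp add: R_def powr_mult powr_def[of "exp 1"])
  finally show ?thesis
    by (simp add: R_def mult.assoc mult.commute mult.left_commute)
qed

text \<open>The two-parameter Mittag-Leffler function E_{\<alpha>,b}. Differentiating the case b = 1
  leads to b = \<alpha>, and fractional integration raises b.\<close>

definition wiman :: "real \<Rightarrow> real \<Rightarrow> real \<Rightarrow> real" where
  "wiman \<alpha> b z = (\<Sum>n. z ^ n / Gamma (b + real n * \<alpha>))"

lemma mittag_leffler_eq_wiman: "mittag_leffler \<alpha> = wiman \<alpha> 1"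
  by (simp add: fun_eq_iff mittag_leffler_def wiman_def)

lemma summable_wiman:
  assumes "0 < \<alpha>" "0 < b"
  shows "summable (\<lambda>n. \<bar>z\<bar> ^ n / Gamma (b + real n * \<alpha>))"
proof (rule summable_comparison_test')
  define q where "q = 2 * \<bar>z\<bar> + 1"
  \<comment> \<open>With r^\<alpha> = q the lower bound for Gamma(b + n \<alpha>) becomes K q^n, and
    q > |z| leaves a convergent geometric series.\<close>
  define r where "r = q powr (1 / \<alpha>)"
  define K where "K = exp (- (exp 1 * r)) * r powr b"
  have q: "q > 0" by (simp add: q_def)
  then have r: "r > 0" by (simp add: r_def)
  then have K: "K > 0" by (simp add: K_def)
  show "summable (\<lambda>n. (1 / K) * (\<bar>z\<bar> / q) ^ n)"
    by (intro summable_mult summable_geometric) (simp add: q_def)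
  fix n :: nat
  have b: "b + real n * \<alpha> > 0" using assms by (simp add: add_pos_nonneg)
  have "r powr (real n * \<alpha>) = q ^ n"
    using q assms by (simp add: r_def powr_powr powr_realpow)
  then have "K * q ^ n = exp (- (exp 1 * r)) * r powr (b + real n * \<alpha>)"
    by (simp add: K_def powr_add)
  also have "\<dots> \<le> Gamma (b + real n * \<alpha>)"
    by (rule Gamma_ge_powr) fact+
  finally have "\<bar>z\<bar> ^ n / Gamma (b + real n * \<alpha>) \<le> \<bar>z\<bar> ^ n / (K * q ^ n)"
    using K q by (intro divide_left_mono mult_pos_pos Gamma_real_pos b) auto
  then show "norm (\<bar>z\<bar> ^ n / Gamma (b + real n * \<alpha>)) \<le> (1 / K) * (\<bar>z\<bar> / q) ^ n"
    using Gamma_real_pos[OF b] by (simp add: power_divide abs_of_pos)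
qed

lemma summable_wiman':
  assumes "0 < \<alpha>" "0 < b"
  shows "summable (\<lambda>n. z ^ n / Gamma (b + real n * \<alpha>))"
proof (rule summable_norm_cancel)
  have "norm (z ^ n / Gamma (b + real n * \<alpha>)) = \<bar>z\<bar> ^ n / Gamma (b + real n * \<alpha>)" for n
    using Gamma_real_pos[of "b + real n * \<alpha>"] assms by (simp add: power_abs add_pos_nonneg abs_of_pos)
  then show "summable (\<lambda>n. norm (z ^ n / Gamma (b + real n * \<alpha>)))"
    using summable_wiman[OF assms] by simp
qed

lemma mult_wiman_add:
  assumes "0 < \<alpha>" "0 < b"
  shows "z * wiman \<alpha> (b + \<alpha>) z = wiman \<alpha> b z - 1 / Gamma b"
proof -
  have "z * wiman \<alpha> (b + \<alpha>) z = (\<Sum>n. z * (z ^ n / Gamma (b + \<alpha> + real n * \<alpha>)))"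
    unfolding wiman_def using assms by (intro suminf_mult[symmetric] summable_wiman') auto
  also have "(\<lambda>n. z * (z ^ n / Gamma (b + \<alpha> + real n * \<alpha>))) = (\<lambda>n. z ^ Suc n / Gamma (b + real (Suc n) * \<alpha>))"
    by (simp add: fun_eq_iff algebra_simps)
  also have "suminf \<dots> = wiman \<alpha> b z - 1 / Gamma b"
    using suminf_split_head[OF summable_wiman'[OF assms, of z]] by (simp add: wiman_def)
  finally show ?thesis .
qed

text \<open>The factor n + 1 from termwise differentiation cancels in Gamma(1 + (n + 1) \<alpha>) =
  \<alpha> (n + 1) Gamma(\<alpha> + n \<alpha>).\<close>

lemma wiman_1_deriv:
  assumes "0 < \<alpha>"
  shows "(wiman \<alpha> 1 has_real_derivative wiman \<alpha> \<alpha> z / \<alpha>) (at z)"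
proof -
  define c where "c n = 1 / Gamma (1 + real n * \<alpha>)" for n
  have "DERIV (\<lambda>z. \<Sum>n. c n * z ^ n) z :> (\<Sum>n. diffs c n * z ^ n)"
    using summable_wiman'[OF assms zero_less_one]
    by (intro termdiffs_strong_converges_everywhere) (simp add: c_def)
  also have "(\<lambda>z. \<Sum>n. c n * z ^ n) = wiman \<alpha> 1"
    by (simp add: wiman_def c_def fun_eq_iff)
  also have "(\<lambda>n. diffs c n * z ^ n) = (\<lambda>n. z ^ n / Gamma (\<alpha> + real n * \<alpha>) / \<alpha>)"
  proof
    fix n
    have pos: "\<alpha> + real n * \<alpha> > 0" using assms by (simp add: add_pos_nonneg)
    then have "Gamma (\<alpha> + real n * \<alpha> + 1) = (\<alpha> + real n * \<alpha>) * Gamma (\<alpha> + real n * \<alpha>)"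
      by (intro Gamma_plus1) (auto elim!: nonpos_Ints_cases)
    then have "Gamma (1 + real (Suc n) * \<alpha>) = \<alpha> * real (Suc n) * Gamma (\<alpha> + real n * \<alpha>)"
      by (simp add: algebra_simps)
    then show "diffs c n * z ^ n = z ^ n / Gamma (\<alpha> + real n * \<alpha>) / \<alpha>"
      using assms Gamma_real_pos[OF pos] by (simp add: diffs_def c_def field_simps del: of_nat_Suc)
  qed
  also have "suminf \<dots> = wiman \<alpha> \<alpha> z / \<alpha>"
    unfolding wiman_def using assms by (intro suminf_divide summable_wiman')
  finally show ?thesis .
qed

text \<open>A crude exponential bound, which ignores the alternating signs, is all that the
  injectivity of the Laplace transform needs.\<close>

lemma mittag_leffler_growth:
  assumes "0 < \<alpha>" "0 \<le> x"
  shows "\<bar>mittag_leffler \<alpha> (- (x powr \<alpha>))\<bar> \<le> exp 3 / (1 - (1 / 2) powr \<alpha>) * exp (6 * x)"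
proof -
  \<comment> \<open>This choice gives x / r \<le> 1/2, hence the ratio \<open>q\<close> =
    (1/2)^\<alpha> for all x at once. Replacing e by 3 in \<open>Gamma_ge_powr\<close> costs the
    factor exp(3 r) = exp 3 * exp(6 x).\<close>
  define r where "r = 2 * x + 1"
  define q where "q = (1 / 2 :: real) powr \<alpha>"
  have r: "1 \<le> r" using assms by (simp add: r_def)
  have q: "0 < q" "q < 1" using assms powr_less_mono'[of "1/2" 0 \<alpha>] by (auto simp: q_def)
  have bound: "norm ((- (x powr \<alpha>)) ^ n / Gamma (1 + real n * \<alpha>)) \<le> exp (3 * r) * q ^ n" for n
  proof -
    have "exp (- (3 * r)) * (r powr \<alpha>) ^ n \<le> exp (- (exp 1 * r)) * r powr (1 + real n * \<alpha>)"
    proof (rule mult_mono)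
      show "exp (- (3 * r)) \<le> exp (- (exp 1 * r))"
        using exp_le r by simp
      have "(r powr \<alpha>) ^ n = r powr (real n * \<alpha>)"
        using r by (simp add: powr_powr mult.commute flip: powr_realpow)
      also have "\<dots> \<le> r powr (1 + real n * \<alpha>)" using r by (intro powr_mono) auto
      finally show "(r powr \<alpha>) ^ n \<le> r powr (1 + real n * \<alpha>)" .
    qed (use r in auto)
    also have "\<dots> \<le> Gamma (1 + real n * \<alpha>)"
      using r assms by (intro Gamma_ge_powr) (auto simp: add_pos_nonneg)
    finally have G: "exp (- (3 * r)) * (r powr \<alpha>) ^ n \<le> Gamma (1 + real n * \<alpha>)" .
    have "norm ((- (x powr \<alpha>)) ^ n / Gamma (1 + real n * \<alpha>)) = (x powr \<alpha>) ^ n / Gamma (1 + real n * \<alpha>)"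
      using Gamma_real_pos[of "1 + real n * \<alpha>"] assms
      by (simp add: power_abs add_pos_nonneg abs_of_pos)
    also have "\<dots> \<le> (x powr \<alpha>) ^ n / (exp (- (3 * r)) * (r powr \<alpha>) ^ n)"
      using r assms G by (intro divide_left_mono mult_pos_pos Gamma_real_pos) (auto simp: add_pos_nonneg)
    also have "\<dots> = exp (3 * r) * ((x / r) powr \<alpha>) ^ n"
      using r assms by (simp add: powr_divide power_divide exp_minus field_simps)
    also have "\<dots> \<le> exp (3 * r) * q ^ n"
      unfolding q_def using r assms
      by (intro mult_left_mono power_mono powr_mono2) (auto simp: r_def field_simps)
    finally show ?thesis .
  qed
  have s: "summable (\<lambda>n. exp (3 * r) * q ^ n)"
    using q by (intro summable_mult summable_geometric) auto
  have "norm (mittag_leffler \<alpha> (- (x powr \<alpha>))) \<le> (\<Sum>n. exp (3 * r) * q ^ n)"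
    unfolding mittag_leffler_def by (rule norm_suminf_le[OF bound s])
  also have "\<dots> = exp (3 * r) / (1 - q)"
    using q by (subst suminf_mult) (auto simp: suminf_geometric summable_geometric)
  also have "exp (3 * r) = exp 3 * exp (6 * x)"
    by (simp add: r_def algebra_simps flip: exp_add)
  finally show ?thesis by (simp add: q_def)
qed

text \<open>Each term integrates to a power because its Gamma factor cancels. For s > 1 the ratio
  s^(-\<alpha>) is below 1, so the integrals of the absolute values are summable and the interchange
  is legitimate.\<close>

lemma mittag_leffler_laplace:
  assumes "0 < \<alpha>" "1 < s"
  shows "integrable lborel (\<lambda>x. indicator {0<..} x * (exp (- s * x) * mittag_leffler \<alpha> (- (x powr \<alpha>))))"
    and "(LINT x|lborel. indicator {0<..} x * (exp (- s * x) * mittag_leffler \<alpha> (- (x powr \<alpha>))))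
           = 1 / (s * (1 + s powr (- \<alpha>)))"
proof -
  define f where "f n x = (- 1) ^ n / Gamma (1 + real n * \<alpha>) *
    (indicator {0<..} x * (x powr (1 + real n * \<alpha> - 1) * exp (- s * x)))" for n and x :: real
  define q where "q = s powr (- \<alpha>)"
  have q: "0 < q" "q < 1" using assms powr_less_mono[of "- \<alpha>" 0 s] by (auto simp: q_def)
  have pos: "0 < 1 + real n * \<alpha>" for n using assms by (simp add: add_pos_nonneg)
  have G: "0 < Gamma (1 + real n * \<alpha>)" for n by (rule Gamma_real_pos[OF pos])
  have sp: "s powr (1 + real n * \<alpha>) = s / q ^ n" for n
    using assms by (simp add: q_def powr_add powr_minus power_inverse powr_powr field_simps flip: powr_realpow)
  have b: "has_bochner_integral lborel (f n) ((- 1) ^ n / Gamma (1 + real n * \<alpha>) * (Gamma (1 + real n * \<alpha>) / s powr (1 + real n * \<alpha>)))" for n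
    unfolding f_def using assms
    by (intro has_bochner_integral_mult_right has_bochner_integral_powr_exp pos) auto
  then have fi: "integrable lborel (f n)" and fv: "integral\<^sup>L lborel (f n) = 1 / s * (- q) ^ n" for n
    using G[of n] sp[of n] by (auto simp: has_bochner_integral_iff power_minus[of q])
  have nf: "norm (f n x) = 1 / Gamma (1 + real n * \<alpha>) *
    (indicator {0<..} x * (x powr (1 + real n * \<alpha> - 1) * exp (- s * x)))" for n x
    using G[of n] by (simp add: f_def abs_mult power_abs)
  have "has_bochner_integral lborel (\<lambda>x. norm (f n x)) (1 / Gamma (1 + real n * \<alpha>) * (Gamma (1 + real n * \<alpha>) / s powr (1 + real n * \<alpha>)))" for n
    unfolding nf using assms
    by (intro has_bochner_integral_mult_right has_bochner_integral_powr_exp pos) auto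
  then have nv: "(LINT x|lborel. norm (f n x)) = 1 / s * q ^ n" for n
    using G[of n] sp[of n] by (auto simp: has_bochner_integral_iff)
  have feq: "f n x = indicator {0<..} x * exp (- s * x) * ((- (x powr \<alpha>)) ^ n / Gamma (1 + real n * \<alpha>))" for n x
  proof (cases "x > 0")
    case True
    then have "x powr (real n * \<alpha>) = (x powr \<alpha>) ^ n"
      by (simp add: powr_powr mult.commute flip: powr_realpow)
    then show ?thesis using True by (simp add: f_def power_minus[of "x powr \<alpha>"])
  qed (simp add: f_def)
  have sums: "(\<Sum>n. f n x) = indicator {0<..} x * (exp (- s * x) * mittag_leffler \<alpha> (- (x powr \<alpha>)))" for x
    unfolding feq mittag_leffler_def
    by (subst suminf_mult[OF summable_wiman'[OF assms(1) zero_less_one]]) (simp add: mult.assoc)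
  have snorm: "summable (\<lambda>n. norm (f n x))" for x
  proof -
    have "norm (f n x) = indicator {0<..} x * exp (- s * x) * (\<bar>x powr \<alpha>\<bar> ^ n / Gamma (1 + real n * \<alpha>))" for n
      unfolding feq using G[of n] by (simp add: abs_mult power_abs)
    then show ?thesis
      by (simp only:) (intro summable_mult summable_wiman assms zero_less_one)
  qed
  have sint: "summable (\<lambda>n. LINT x|lborel. norm (f n x))"
    unfolding nv using q by (intro summable_mult summable_geometric) auto
  show "integrable lborel (\<lambda>x. indicator {0<..} x * (exp (- s * x) * mittag_leffler \<alpha> (- (x powr \<alpha>))))"
    using integrable_suminf[OF fi AE_I2[OF snorm] sint] unfolding sums .
  have "(LINT x|lborel. (\<Sum>n. f n x)) = (\<Sum>n. 1 / s * (- q) ^ n)"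
    using integral_suminf[OF fi AE_I2[OF snorm] sint] unfolding fv .
  also have "\<dots> = 1 / s * (1 / (1 - (- q)))"
    using q by (subst suminf_mult) (auto simp: suminf_geometric summable_geometric)
  finally show "(LINT x|lborel. indicator {0<..} x * (exp (- s * x) * mittag_leffler \<alpha> (- (x powr \<alpha>))))
           = 1 / (s * (1 + s powr (- \<alpha>)))"
    unfolding sums by (simp add: q_def)
qed

lemma continuous_on_mittag_leffler:
  assumes "0 < \<alpha>"
  shows "continuous_on {0..} (\<lambda>x. mittag_leffler \<alpha> (- (x powr \<alpha>)))"
proof (rule continuous_on_compose2[of UNIV "mittag_leffler \<alpha>"])
  show "continuous_on UNIV (mittag_leffler \<alpha>)"
    unfolding mittag_leffler_eq_wiman
    using wiman_1_deriv[OF assms] DERIV_isCont continuous_at_imp_continuous_on by blast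
  show "continuous_on {0..} (\<lambda>x. - (x powr \<alpha>))"
    using assms by (intro continuous_intros continuous_on_powr') auto
qed auto

section \<open>The Laplace transform of the kernel and its identification with the series\<close>

definition strip_laplace :: "real \<Rightarrow> real \<Rightarrow> real" where
  "strip_laplace \<alpha> x = (LINT v|lborel. strip_kernel \<alpha> v * exp (- (x * exp v)))"

lemma strip_kernel_exp_bounds:
  assumes "0 < \<alpha>" "\<alpha> < 1" "0 \<le> x"
  shows "0 \<le> strip_kernel \<alpha> v * exp (- (x * exp v))"
    and "strip_kernel \<alpha> v * exp (- (x * exp v)) \<le> strip_kernel \<alpha> v"
proof -
  have "0 < strip_kernel \<alpha> v" by (rule strip_kernel_pos) fact+
  then show "0 \<le> strip_kernel \<alpha> v * exp (- (x * exp v))"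
    and "strip_kernel \<alpha> v * exp (- (x * exp v)) \<le> strip_kernel \<alpha> v"
    using assms(3) by (auto simp: mult_le_cancel_left2)
qed

lemma strip_laplace_integrable:
  assumes "0 < \<alpha>" "\<alpha> < 1" "0 \<le> x"
  shows "integrable lborel (\<lambda>v. strip_kernel \<alpha> v * exp (- (x * exp v)))"
proof (rule Bochner_Integration.integrable_bound[OF strip_kernel_integrable[OF assms(1,2)]])
  note [measurable] = borel_measurable_strip_kernel[OF assms(1,2)]
  show "(\<lambda>v. strip_kernel \<alpha> v * exp (- (x * exp v))) \<in> borel_measurable lborel" by measurable
qed (use assms in \<open>auto simp: abs_mult mult_le_cancel_left2 not_less\<close>)

lemma strip_laplace_bounds:
  assumes "0 < \<alpha>" "\<alpha> < 1" "0 \<le> x"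
  shows "0 \<le> strip_laplace \<alpha> x" "strip_laplace \<alpha> x \<le> integral\<^sup>L lborel (strip_kernel \<alpha>)"
  unfolding strip_laplace_def
  using strip_kernel_exp_bounds[OF assms]
  by (auto intro!: integral_nonneg_AE integral_mono strip_laplace_integrable[OF assms]
    strip_kernel_integrable assms simp del: mult_minus_left)

lemma continuous_on_strip_laplace:
  assumes "0 < \<alpha>" "\<alpha> < 1"
  shows "continuous_on {0..} (strip_laplace \<alpha>)"
  unfolding continuous_on_sequentially
proof (intro ballI allI impI; elim conjE)
  note [measurable] = borel_measurable_strip_kernel[OF assms]
  fix X :: "nat \<Rightarrow> real" and x assume x: "x \<in> {0..}" "\<forall>n. X n \<in> {0..}" "X \<longlonglongrightarrow> x"
  show "(strip_laplace \<alpha> \<circ> X) \<longlonglongrightarrow> strip_laplace \<alpha> x"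
    unfolding strip_laplace_def comp_def
  proof (rule integral_dominated_convergence[OF _ _ strip_kernel_integrable[OF assms]])
    show "AE v in lborel. (\<lambda>n. strip_kernel \<alpha> v * exp (- (X n * exp v))) \<longlonglongrightarrow> strip_kernel \<alpha> v * exp (- (x * exp v))"
      by (intro AE_I2 tendsto_intros x)
    show "AE v in lborel. norm (strip_kernel \<alpha> v * exp (- (X n * exp v))) \<le> strip_kernel \<alpha> v" for n
      using x strip_kernel_exp_bounds[OF assms, of "X n"] by (intro AE_I2) simp
  qed measurable
qed

text \<open>By Fubini, the inner integral over x is 1 / (s + exp v), and the remaining integral is
  \<open>strip_kernel_stieltjes\<close> at y = ln s.\<close>

lemma strip_laplace_laplace:
  assumes "0 < \<alpha>" "\<alpha> < 1" "0 < s"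
  shows "integrable lborel (\<lambda>x. indicator {0<..} x * (exp (- s * x) * strip_laplace \<alpha> x))"
    and "(LINT x|lborel. indicator {0<..} x * (exp (- s * x) * strip_laplace \<alpha> x)) = 1 / (s * (1 + s powr (- \<alpha>)))"
proof -
  note [measurable] = borel_measurable_strip_kernel[OF assms(1,2)]
  note K = strip_kernel_integrable[OF assms(1,2)]
  define f where "f x v = indicat_real {0<..} x * (exp (- s * x) * (strip_kernel \<alpha> v * exp (- (x * exp v))))" for x v
  have ie: "integrable lborel (\<lambda>x. indicat_real {0<..} x * exp (- s * x))"
    using has_bochner_integral_exp_neg[OF assms(3)] by (simp add: has_bochner_integral_iff)
  have inner: "(LINT v|lborel. f x v) = indicator {0<..} x * (exp (- s * x) * strip_laplace \<alpha> x)" for x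
    by (simp add: f_def strip_laplace_def)
  have fnn: "0 \<le> f x v" for x v
    using strip_kernel_pos[OF assms(1,2), of v] by (simp add: f_def)
  have meas: "case_prod f \<in> borel_measurable (lborel \<Otimes>\<^sub>M lborel)"
    unfolding f_def by measurable
  have Lm: "(\<lambda>x. LINT v|lborel. f x v) \<in> borel_measurable lborel"
    using meas by measurable
  note Lb = strip_laplace_bounds[OF assms(1,2)]
  have iL: "integrable lborel (\<lambda>x. LINT v|lborel. f x v)"
  proof (rule Bochner_Integration.integrable_bound[OF _ Lm])
    show "integrable lborel (\<lambda>x. integral\<^sup>L lborel (strip_kernel \<alpha>) * (indicat_real {0<..} x * exp (- s * x)))"
      by (intro integrable_mult_right ie)
    show "AE x in lborel. norm (LINT v|lborel. f x v) \<le>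
        norm (integral\<^sup>L lborel (strip_kernel \<alpha>) * (indicat_real {0<..} x * exp (- s * x)))"
    proof (intro AE_I2)
      fix x :: real
      show "norm (LINT v|lborel. f x v) \<le>
        norm (integral\<^sup>L lborel (strip_kernel \<alpha>) * (indicat_real {0<..} x * exp (- s * x)))"
        unfolding inner using Lb(1)[of x] Lb(2)[of x]
        by (cases "0 < x") (auto simp: abs_mult mult.commute intro!: mult_left_mono)
    qed
  qed
  then show "integrable lborel (\<lambda>x. indicator {0<..} x * (exp (- s * x) * strip_laplace \<alpha> x))"
    unfolding inner .
  have fi: "integrable lborel (f x)" for x
    unfolding f_def[abs_def]
    by (cases "0 < x") (auto intro!: integrable_mult_right strip_laplace_integrable assms)
  have prod: "integrable (lborel \<Otimes>\<^sub>M lborel) (case_prod f)"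
    by (rule lborel_pair.Fubini_integrable[OF meas]) (use fnn iL fi in auto)
  have "(LINT x|lborel. LINT v|lborel. f x v) = (LINT v|lborel. LINT x|lborel. f x v)"
    by (rule lborel_pair.Fubini_integral[OF prod, symmetric])
  also have "(\<lambda>v. LINT x|lborel. f x v) = (\<lambda>v. 1 / s * (strip_kernel \<alpha> v / (1 + exp (v - ln s))))"
  proof
    fix v
    have sv: "0 < s + exp v" using assms by (simp add: add_pos_pos)
    have "f x v = strip_kernel \<alpha> v * (indicat_real {0<..} x * exp (- (s + exp v) * x))" for x
      by (simp add: f_def algebra_simps flip: exp_add)
    then have "(LINT x|lborel. f x v) = strip_kernel \<alpha> v * (1 / (s + exp v))"
      using has_bochner_integral_exp_neg[OF sv] by (simp add: has_bochner_integral_iff)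
    also have "s + exp v = s * (1 + exp (v - ln s))"
      using assms by (simp add: exp_diff field_simps)
    finally show "(LINT x|lborel. f x v) = 1 / s * (strip_kernel \<alpha> v / (1 + exp (v - ln s)))" by simp
  qed
  also have "(LINT v|lborel. 1 / s * (strip_kernel \<alpha> v / (1 + exp (v - ln s)))) = 1 / s * (1 / (1 + exp (- \<alpha> * ln s)))"
    by (simp only: integral_mult_right_zero strip_kernel_stieltjes[OF assms(1,2)])
  also have "exp (- \<alpha> * ln s) = s powr (- \<alpha>)" using assms by (simp add: powr_def)
  finally show "(LINT x|lborel. indicator {0<..} x * (exp (- s * x) * strip_laplace \<alpha> x)) = 1 / (s * (1 + s powr (- \<alpha>)))"
    unfolding inner by simp
qed

lemma mittag_leffler_eq_strip_laplace:
  assumes "0 < \<alpha>" "\<alpha> < 1" "0 \<le> x"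
  shows "mittag_leffler \<alpha> (- (x powr \<alpha>)) = strip_laplace \<alpha> x"
proof -
  let ?C = "exp 3 / (1 - (1 / 2) powr \<alpha>)" and ?K = "integral\<^sup>L lborel (strip_kernel \<alpha>)"
  let ?g = "\<lambda>x. mittag_leffler \<alpha> (- (x powr \<alpha>)) - strip_laplace \<alpha> x"
  have "?g x = 0"
  \<comment> \<open>The rate 6 and the constant \<open>?C\<close> come from
    \<open>mittag_leffler_growth\<close>; the kernel integral is bounded by its total mass
    \<open>?K\<close>.\<close>
  proof (rule laplace_transform_eq_zero_imp[where g="?g" and c=6 and C="?C + ?K"])
    show "continuous_on {0..} ?g"
      by (intro continuous_on_diff continuous_on_mittag_leffler continuous_on_strip_laplace assms)
    fix x :: real assume x: "0 \<le> x"
    note b = strip_laplace_bounds[OF assms(1,2) x]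
    have "0 \<le> ?K" using b by linarith
    then have "?K \<le> ?K * exp (6 * x)" using x by (simp add: mult_le_cancel_left1)
    with b show "\<bar>?g x\<bar> \<le> (?C + ?K) * exp (6 * x)"
      using mittag_leffler_growth[OF assms(1) x] by (simp only: distrib_right)
  next
    fix s :: real assume s: "6 < s"
    have s': "1 < s" "0 < s" using s by auto
    have "indicator {0<..} x * (exp (- s * x) * ?g x) =
      indicator {0<..} x * (exp (- s * x) * mittag_leffler \<alpha> (- (x powr \<alpha>))) -
      indicator {0<..} x * (exp (- s * x) * strip_laplace \<alpha> x)" for x
      by (simp add: algebra_simps)
    then show "(LINT x|lborel. indicator {0<..} x * (exp (- s * x) * ?g x)) = 0"
      using mittag_leffler_laplace[OF assms(1) s'(1)] strip_laplace_laplace[OF assms(1,2) s'(2)] by simp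
  qed fact
  then show ?thesis by simp
qed

subsection \<open>Volterra equations and bounds\<close>

lemma has_bochner_integral_Beta:
  fixes a b :: real
  assumes "0 < a" "0 < b"
  shows "has_bochner_integral lborel (\<lambda>u. indicator {0<..<1} u * (u powr (a - 1) * (1 - u) powr (b - 1))) (Beta a b)"
proof (rule has_bochner_integral_nn_integral)
  have B: "0 \<le> Beta a b"
    using assms by (simp add: Beta_def Gamma_real_pos less_imp_le)
  then show "0 \<le> Beta a b" .
  have "(\<integral>\<^sup>+u. ennreal (indicator {0<..<1} u * (u powr (a - 1) * (1 - u) powr (b - 1))) \<partial>lborel) =
    (\<integral>\<^sup>+u. ennreal (indicator {0..1} u * (u powr (a - 1) * (1 - u) powr (b - 1))) \<partial>lborel)"
    by (intro nn_integral_cong) (auto simp: indicator_def)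
  also have "\<dots> = ennreal (Beta a b)"
    by (rule nn_integral_has_integral_lebesgue[OF _ has_integral_Beta_real[OF assms]]) auto
  finally show "(\<integral>\<^sup>+u. ennreal (indicator {0<..<1} u * (u powr (a - 1) * (1 - u) powr (b - 1))) \<partial>lborel) = ennreal (Beta a b)" .
qed (auto simp: indicator_def)

text \<open>The Riemann-Liouville integral of order a of t^(b - 1) E_{\<alpha>,b}(z t^\<alpha>) up
  to t = 1, without its factor 1 / Gamma(a). It follows termwise from the Beta integral. The pair a
  = \<alpha>, b = 1 yields the Volterra equation; a = 1 and a = 1 - \<alpha> with b = \<alpha> yield
  \<open>one_minus_strip_laplace_le\<close>.\<close>

lemma has_bochner_integral_wiman:
  fixes \<alpha> a b z :: real
  assumes "0 < \<alpha>" "0 < a" "0 < b"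
  shows "has_bochner_integral lborel
           (\<lambda>u. indicator {0<..<1} u * (u powr (b - 1) * (1 - u) powr (a - 1)) * wiman \<alpha> b (z * u powr \<alpha>))
           (Gamma a * wiman \<alpha> (a + b) z)"
proof -
  define g where "g n u = indicator {0<..<1} u * (u powr (b + real n * \<alpha> - 1) * (1 - u) powr (a - 1))" for n and u :: real
  define f where "f n u = z ^ n / Gamma (b + real n * \<alpha>) * g n u" for n u
  have pos: "0 < b + real n * \<alpha>" "0 < a + b + real n * \<alpha>" for n using assms by (simp_all add: add_pos_nonneg)
  have G: "0 < Gamma (b + real n * \<alpha>)" "0 < Gamma (a + b + real n * \<alpha>)" for n by (intro Gamma_real_pos pos)+
  have g: "has_bochner_integral lborel (g n) (Beta (b + real n * \<alpha>) a)" for n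
    unfolding g_def using assms pos by (intro has_bochner_integral_Beta) auto
  have gnn: "0 \<le> g n u" for n u by (simp add: g_def indicator_def)
  have Beta: "Beta (b + real n * \<alpha>) a = Gamma (b + real n * \<alpha>) * (Gamma a / Gamma (a + b + real n * \<alpha>))" for n
    by (simp add: Beta_def add_ac)
  have fv: "integral\<^sup>L lborel (f n) = Gamma a * (z ^ n / Gamma (a + b + real n * \<alpha>))" and fi: "integrable lborel (f n)" for n
    using g[of n] G[of n] unfolding f_def by (auto simp: has_bochner_integral_iff Beta)
  have nf: "norm (f n u) = \<bar>z\<bar> ^ n / Gamma (b + real n * \<alpha>) * g n u" for n u
    using G[of n] gnn[of n u] by (simp add: f_def abs_mult power_abs)
  have nv: "(LINT u|lborel. norm (f n u)) = Gamma a * (\<bar>z\<bar> ^ n / Gamma (a + b + real n * \<alpha>))" for n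
    unfolding nf using g[of n] G[of n] by (auto simp: has_bochner_integral_iff Beta)
  have g_eq: "g n u = indicator {0<..<1} u * (u powr (b - 1) * (1 - u) powr (a - 1)) * (u powr \<alpha>) ^ n" for n u
  proof (cases "u > 0")
    case True
    then have "(u powr \<alpha>) ^ n = u powr (real n * \<alpha>)"
      by (simp add: powr_powr mult.commute flip: powr_realpow)
    then show ?thesis by (simp add: g_def algebra_simps flip: powr_add)
  qed (simp add: g_def)
  have feq: "f n u = indicator {0<..<1} u * (u powr (b - 1) * (1 - u) powr (a - 1)) * ((z * u powr \<alpha>) ^ n / Gamma (b + real n * \<alpha>))" for n u
    by (simp add: f_def g_eq power_mult_distrib)
  have sums: "(\<Sum>n. f n u) = indicator {0<..<1} u * (u powr (b - 1) * (1 - u) powr (a - 1)) * wiman \<alpha> b (z * u powr \<alpha>)" for u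
    unfolding feq wiman_def by (rule suminf_mult[OF summable_wiman'[OF assms(1,3)]])
  have snorm: "summable (\<lambda>n. norm (f n u))" for u
  proof -
    have "norm (f n u) = indicator {0<..<1} u * (u powr (b - 1) * (1 - u) powr (a - 1)) * (\<bar>z * u powr \<alpha>\<bar> ^ n / Gamma (b + real n * \<alpha>))" for n
      unfolding nf g_eq by (simp add: abs_mult power_mult_distrib)
    then show ?thesis
      by (simp only:) (intro summable_mult summable_wiman assms)
  qed
  have sint: "summable (\<lambda>n. LINT u|lborel. norm (f n u))"
    unfolding nv using assms by (intro summable_mult summable_wiman) auto
  have "(LINT u|lborel. (\<Sum>n. f n u)) = (\<Sum>n. Gamma a * (z ^ n / Gamma (a + b + real n * \<alpha>)))"
    using integral_suminf[OF fi AE_I2[OF snorm] sint] unfolding fv .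
  also have "\<dots> = Gamma a * wiman \<alpha> (a + b) z"
    unfolding wiman_def using assms by (intro suminf_mult summable_wiman') auto
  finally show ?thesis
    using integrable_suminf[OF fi AE_I2[OF snorm] sint] unfolding sums has_bochner_integral_iff by simp
qed

lemma integral_lborel_pos:
  fixes f :: "real \<Rightarrow> real"
  assumes "integrable lborel f" "\<And>x. 0 \<le> f x" "a < b" "\<And>x. a < x \<Longrightarrow> x < b \<Longrightarrow> 0 < f x"
  shows "0 < (LINT x|lborel. f x)"
proof -
  have "0 \<le> (LINT x|lborel. f x)"
    using assms(2) by (intro integral_nonneg_AE AE_I2)
  moreover have "(LINT x|lborel. f x) \<noteq> 0"
  proof
    assume "(LINT x|lborel. f x) = 0"
    then have "AE x in lborel. f x = 0"
      using integral_nonneg_eq_0_iff_AE[OF assms(1)] assms(2) by auto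
    then have "AE x in lborel. x \<notin> {a<..<b}"
      by eventually_elim (use assms(4) in force)
    then have "{a<..<b} \<in> null_sets lborel"
      by (subst AE_iff_null_sets) auto
    then show False using assms(3) by (simp add: null_sets_def)
  qed
  ultimately show ?thesis by simp
qed

lemma strip_laplace_strict_antimono:
  assumes "0 < \<alpha>" "\<alpha> < 1" "0 \<le> x" "x < y"
  shows "strip_laplace \<alpha> y < strip_laplace \<alpha> x"
proof -
  have y: "0 \<le> y" using assms by simp
  have le: "strip_kernel \<alpha> v * exp (- (y * exp v)) < strip_kernel \<alpha> v * exp (- (x * exp v))" for v
    using assms by (intro mult_strict_left_mono strip_kernel_pos) auto
  have "0 < (LINT v|lborel. strip_kernel \<alpha> v * exp (- (x * exp v)) - strip_kernel \<alpha> v * exp (- (y * exp v)))"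
    by (rule integral_lborel_pos[of _ 0 1])
       (use le less_imp_le[OF le] strip_laplace_integrable[OF assms(1,2)] assms(3) y in auto)
  then show ?thesis
    unfolding strip_laplace_def
    using strip_laplace_integrable[OF assms(1,2,3)] strip_laplace_integrable[OF assms(1,2) y]
    by (subst (asm) Bochner_Integration.integral_diff) auto
qed

lemma strip_laplace_eq_wiman:
  assumes "0 < \<alpha>" "\<alpha> < 1" "0 \<le> x"
  shows "strip_laplace \<alpha> x = wiman \<alpha> 1 (- (x powr \<alpha>))"
  using mittag_leffler_eq_strip_laplace[OF assms] by (simp add: mittag_leffler_eq_wiman)

lemma strip_laplace_pos:
  assumes "0 < \<alpha>" "\<alpha> < 1" "0 \<le> x"
  shows "0 < strip_laplace \<alpha> x"
  using strip_laplace_strict_antimono[OF assms, of "x + 1"] strip_laplace_bounds(1)[OF assms(1,2), of "x + 1"] assms(3)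
  by simp

lemma one_minus_strip_laplace:
  assumes "0 < \<alpha>" "\<alpha> < 1" "0 \<le> x"
  shows "1 - strip_laplace \<alpha> x = x powr \<alpha> * wiman \<alpha> (1 + \<alpha>) (- (x powr \<alpha>))"
  using mult_wiman_add[OF assms(1) zero_less_one, of "- (x powr \<alpha>)"]
  by (simp add: strip_laplace_eq_wiman[OF assms])

text \<open>The equation e + I^\<alpha> e = 1, with the fractional integral over (0, x) rescaled to
  (0, 1) and multiplied by Gamma(1 + \<alpha>) / x^\<alpha>. In this normalisation the weight is a
  probability density.\<close>

lemma strip_laplace_volterra:
  assumes "0 < \<alpha>" "\<alpha> < 1" "0 < x"
  shows "has_bochner_integral lborel
           (\<lambda>u. indicator {0<..<1} u * (\<alpha> * (1 - u) powr (\<alpha> - 1)) * strip_laplace \<alpha> (x * u))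
           (Gamma (1 + \<alpha>) / x powr \<alpha> * (1 - strip_laplace \<alpha> x))"
proof -
  have "has_bochner_integral lborel
    (\<lambda>u. \<alpha> * (indicator {0<..<1} u * (u powr (1 - 1) * (1 - u) powr (\<alpha> - 1)) * wiman \<alpha> 1 (- (x powr \<alpha>) * u powr \<alpha>)))
    (\<alpha> * (Gamma \<alpha> * wiman \<alpha> (\<alpha> + 1) (- (x powr \<alpha>))))"
    using assms by (intro has_bochner_integral_mult_right has_bochner_integral_wiman) auto
  also have "(\<lambda>u. \<alpha> * (indicator {0<..<1} u * (u powr (1 - 1) * (1 - u) powr (\<alpha> - 1)) * wiman \<alpha> 1 (- (x powr \<alpha>) * u powr \<alpha>)))
    = (\<lambda>u. indicator {0<..<1} u * (\<alpha> * (1 - u) powr (\<alpha> - 1)) * strip_laplace \<alpha> (x * u))"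
    using assms by (auto simp: fun_eq_iff indicator_def strip_laplace_eq_wiman powr_mult)
  also have "\<alpha> * (Gamma \<alpha> * wiman \<alpha> (\<alpha> + 1) (- (x powr \<alpha>))) = Gamma (1 + \<alpha>) / x powr \<alpha> * (1 - strip_laplace \<alpha> x)"
  proof -
    have "Gamma (\<alpha> + 1) = \<alpha> * Gamma \<alpha>"
      using assms by (intro Gamma_plus1) (auto elim!: nonpos_Ints_cases)
    then show ?thesis
      using assms one_minus_strip_laplace[of \<alpha> x] by (simp add: add.commute)
  qed
  finally show ?thesis .
qed

text \<open>Up to the positive factor t^(\<alpha> - 1), this is minus the derivative of t ->
  E_\<alpha>(-t^\<alpha>). A negative value would make that function increase to the right of t,
  against its strict decrease.\<close>

lemma wiman_self_nonneg:
  assumes "0 < \<alpha>" "\<alpha> < 1" "0 < t"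
  shows "0 \<le> wiman \<alpha> \<alpha> (- (t powr \<alpha>))"
proof (rule ccontr)
  assume neg: "\<not> ?thesis"
  define f where "f t = wiman \<alpha> 1 (- (t powr \<alpha>))" for t
  have "((\<lambda>t. t powr \<alpha>) has_real_derivative \<alpha> * t powr (\<alpha> - 1)) (at t)"
    using assms by (intro has_real_derivative_powr)
  then have "(f has_real_derivative wiman \<alpha> \<alpha> (- (t powr \<alpha>)) / \<alpha> * - (\<alpha> * t powr (\<alpha> - 1))) (at t)"
    unfolding f_def by (intro DERIV_chain2[OF wiman_1_deriv[OF assms(1)]] DERIV_minus)
  moreover have "0 < wiman \<alpha> \<alpha> (- (t powr \<alpha>)) / \<alpha> * - (\<alpha> * t powr (\<alpha> - 1))"
    using neg assms by (simp add: mult_neg_pos)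
  ultimately obtain d where d: "d > 0" "\<And>h. 0 < h \<Longrightarrow> h < d \<Longrightarrow> f t < f (t + h)"
    using DERIV_pos_inc_right by blast
  then have "f t < f (t + d / 2)" by simp
  moreover have "f (t + d / 2) < f t"
    using strip_laplace_strict_antimono[OF assms(1,2), of t "t + d / 2"] assms d(1)
    by (simp add: f_def strip_laplace_eq_wiman)
  ultimately show False by simp
qed

text \<open>After division by x^\<alpha>, the left side is an integral of the nonnegative
  E_{\<alpha>,\<alpha>} term with weight (1 - u)^0, and the right side is the same integral with the
  larger weight (1 - u)^(-\<alpha>).\<close>

lemma one_minus_strip_laplace_le:
  assumes "0 < \<alpha>" "\<alpha> < 1" "0 < x"
  shows "1 - strip_laplace \<alpha> x \<le> Gamma (1 - \<alpha>) * x powr \<alpha> * strip_laplace \<alpha> x"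
proof -
  let ?z = "- (x powr \<alpha>)"
  let ?f = "\<lambda>a u. indicator {0<..<1} u * (u powr (\<alpha> - 1) * (1 - u) powr (a - 1)) * wiman \<alpha> \<alpha> (?z * u powr \<alpha>)"
  have 1: "has_bochner_integral lborel (?f 1) (Gamma 1 * wiman \<alpha> (1 + \<alpha>) ?z)"
    using assms by (intro has_bochner_integral_wiman) auto
  have 2: "has_bochner_integral lborel (?f (1 - \<alpha>)) (Gamma (1 - \<alpha>) * wiman \<alpha> (1 - \<alpha> + \<alpha>) ?z)"
    using assms by (intro has_bochner_integral_wiman) auto
  have "(LINT u|lborel. ?f 1 u) \<le> (LINT u|lborel. ?f (1 - \<alpha>) u)"
  proof (rule integral_mono)
    fix u :: real
    show "?f 1 u \<le> ?f (1 - \<alpha>) u"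
    proof (cases "0 < u \<and> u < 1")
      case True
      have "(1 - u) powr (1 - 1) \<le> (1 - u) powr (1 - \<alpha> - 1)"
        using True assms by (intro powr_mono') auto
      moreover have "0 \<le> wiman \<alpha> \<alpha> (?z * u powr \<alpha>)"
        using wiman_self_nonneg[OF assms(1,2), of "x * u"] True assms by (simp add: powr_mult)
      ultimately show ?thesis
        using True by (intro mult_right_mono mult_left_mono) auto
    qed auto
  qed (use 1 2 in \<open>simp_all only: has_bochner_integral_iff\<close>)
  then have "Gamma 1 * wiman \<alpha> (1 + \<alpha>) ?z \<le> Gamma (1 - \<alpha>) * wiman \<alpha> (1 - \<alpha> + \<alpha>) ?z"
    using 1 2 by (simp only: has_bochner_integral_iff)
  then have "x powr \<alpha> * wiman \<alpha> (1 + \<alpha>) ?z \<le> x powr \<alpha> * (Gamma (1 - \<alpha>) * strip_laplace \<alpha> x)"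
    using assms by (simp add: strip_laplace_eq_wiman)
  then show ?thesis
    using one_minus_strip_laplace[of \<alpha> x] assms by (simp add: mult_ac)
qed

lemma has_bochner_integral_powr_density:
  fixes \<alpha> :: real
  assumes "0 < \<alpha>"
  shows "has_bochner_integral lborel (\<lambda>u. indicator {0<..<1} u * (\<alpha> * (1 - u) powr (\<alpha> - 1))) 1"
proof -
  have "has_bochner_integral lborel (\<lambda>u. \<alpha> * (indicator {0<..<1} u * (u powr (1 - 1) * (1 - u) powr (\<alpha> - 1)))) (\<alpha> * Beta 1 \<alpha>)"
    using assms by (intro has_bochner_integral_mult_right has_bochner_integral_Beta) auto
  also have "(\<lambda>u. \<alpha> * (indicator {0<..<1} u * (u powr (1 - 1) * (1 - u) powr (\<alpha> - 1)))) = (\<lambda>u. indicator {0<..<1} u * (\<alpha> * (1 - u) powr (\<alpha> - 1)))"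
    by (auto simp: fun_eq_iff indicator_def)
  also have "\<alpha> * Beta 1 \<alpha> = 1"
  proof -
    have "Gamma (\<alpha> + 1) = \<alpha> * Gamma \<alpha>"
      using assms by (intro Gamma_plus1) (auto elim!: nonpos_Ints_cases)
    then show ?thesis
      using assms Gamma_real_pos[OF assms] by (simp add: Beta_def add.commute less_imp_neq[symmetric])
  qed
  finally show ?thesis .
qed

text \<open>In the Volterra equation the value at x u is replaced by the smaller value at x, and the
  weight integrates to 1.\<close>

lemma one_minus_strip_laplace_greater:
  assumes "0 < \<alpha>" "\<alpha> < 1" "0 < x"
  shows "x powr \<alpha> / Gamma (1 + \<alpha>) * strip_laplace \<alpha> x < 1 - strip_laplace \<alpha> x"
proof -
  let ?w = "\<lambda>u. indicator {0<..<1} u * (\<alpha> * (1 - u) powr (\<alpha> - 1))"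
  note 1 = strip_laplace_volterra[OF assms]
  have 2: "has_bochner_integral lborel (\<lambda>u. ?w u * strip_laplace \<alpha> x) (1 * strip_laplace \<alpha> x)"
    by (intro has_bochner_integral_mult_left has_bochner_integral_powr_density assms)
  have gt: "strip_laplace \<alpha> x < strip_laplace \<alpha> (x * u)" if "0 < u" "u < 1" for u
    using that assms by (intro strip_laplace_strict_antimono) auto
  have "0 < (LINT u|lborel. ?w u * strip_laplace \<alpha> (x * u) - ?w u * strip_laplace \<alpha> x)"
  proof (rule integral_lborel_pos[of _ 0 1])
    show "integrable lborel (\<lambda>u. ?w u * strip_laplace \<alpha> (x * u) - ?w u * strip_laplace \<alpha> x)"
      using has_bochner_integral_diff[OF 1 2] by (simp add: has_bochner_integral_iff)
    show pos: "0 < ?w u * strip_laplace \<alpha> (x * u) - ?w u * strip_laplace \<alpha> x" if "0 < u" "u < 1" for u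
      using that gt[OF that] assms by (simp flip: right_diff_distrib)
    show "0 \<le> ?w u * strip_laplace \<alpha> (x * u) - ?w u * strip_laplace \<alpha> x" for u
      using pos[of u] by (cases "0 < u \<and> u < 1") auto
  qed simp
  also have "\<dots> = Gamma (1 + \<alpha>) / x powr \<alpha> * (1 - strip_laplace \<alpha> x) - 1 * strip_laplace \<alpha> x"
    by (rule has_bochner_integral_integral_eq[OF has_bochner_integral_diff[OF 1 2]])
  finally have "strip_laplace \<alpha> x < Gamma (1 + \<alpha>) / x powr \<alpha> * (1 - strip_laplace \<alpha> x)"
    by simp
  moreover have "0 < Gamma (1 + \<alpha>)" "0 < x powr \<alpha>"
    using assms by (auto intro!: Gamma_real_pos)
  ultimately show ?thesis by (simp add: field_simps)
qed

subsection \<open>The sign change\<close>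

text \<open>The integrand is the derivative of -exp(-x exp v), which rises from -1 to 0. It
  dominates the integrand of \<open>strip_laplace_cdf\<close>, since a distribution function is
  bounded by 1.\<close>

lemma exp_neg_density_integrable:
  fixes x :: real
  assumes "0 < x"
  shows "integrable lborel (\<lambda>v. x * exp v * exp (- (x * exp v)))"
proof -
  have top: "filterlim (\<lambda>v. x * exp v) at_top at_top"
    by (rule filterlim_tendsto_pos_mult_at_top[OF tendsto_const assms exp_at_top])
  have bot: "((\<lambda>v. - exp (- (x * exp v))) \<longlongrightarrow> - exp (- (x * 0))) at_bot"
    by (intro tendsto_intros exp_at_bot)
  have "set_integrable lborel (einterval (-\<infinity>) \<infinity>) (\<lambda>v. x * exp v * exp (- (x * exp v)))"
  proof (rule interval_integral_FTC_nonneg)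
    show "DERIV (\<lambda>v. - exp (- (x * exp v))) v :> x * exp v * exp (- (x * exp v))" for v
      by (auto intro!: derivative_eq_intros)
    show "(((\<lambda>v. - exp (- (x * exp v))) \<circ> real_of_ereal) \<longlongrightarrow> - exp (- (x * 0))) (at_right (-\<infinity>))"
      using bot by (simp add: ereal_tendsto_simps)
    have "((\<lambda>v. - exp (- (x * exp v))) \<longlongrightarrow> - 0) at_top"
      by (intro tendsto_minus filterlim_compose[OF exp_at_bot] filterlim_uminus_at_bot[THEN iffD1] )
         (simp add: top filterlim_uminus_at_bot)
    then show "(((\<lambda>v. - exp (- (x * exp v))) \<circ> real_of_ereal) \<longlongrightarrow> 0) (at_left \<infinity>)"
      by (simp add: ereal_tendsto_simps)
  qed (use assms in \<open>auto intro!: continuous_intros\<close>)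
  then show ?thesis by (simp add: set_integrable_def)
qed

text \<open>Integration by parts. The boundary term exp(-x exp v)
  \<open>strip_cdf \<alpha> v\<close> vanishes at -infinity through the distribution function and at
  infinity through the exponential.\<close>

lemma strip_laplace_cdf:
  assumes "0 < \<alpha>" "\<alpha> < 1" "0 < x"
  shows "has_bochner_integral lborel (\<lambda>v. x * exp v * exp (- (x * exp v)) * strip_cdf \<alpha> v) (strip_laplace \<alpha> x)"
proof -
  let ?k = "\<lambda>v. strip_kernel \<alpha> v * exp (- (x * exp v))"
  let ?g = "\<lambda>v. x * exp v * exp (- (x * exp v)) * strip_cdf \<alpha> v"
  note bounds = strip_cdf_bounds[OF assms(1,2)]
  have [measurable]: "strip_cdf \<alpha> \<in> borel_measurable borel"
    by (rule borel_measurable_continuous_onI[OF strip_cdf_continuous[OF assms(1,2)]])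
  have k: "integrable lborel ?k"
    using assms by (intro strip_laplace_integrable) auto
  have g: "integrable lborel ?g"
  proof (rule Bochner_Integration.integrable_bound[OF exp_neg_density_integrable[OF assms(3)]])
    show "AE v in lborel. norm (?g v) \<le> norm (x * exp v * exp (- (x * exp v)))"
    proof (intro AE_I2)
      fix v
      show "norm (?g v) \<le> norm (x * exp v * exp (- (x * exp v)))"
        using bounds[of v] assms(3) by (simp add: abs_mult mult_le_cancel_left1 mult_left_le)
    qed
  qed measurable
  have top: "filterlim (\<lambda>v. x * exp v) at_top at_top"
    by (rule filterlim_tendsto_pos_mult_at_top[OF tendsto_const assms(3) exp_at_top])
  have etop: "((\<lambda>v. exp (- (x * exp v))) \<longlongrightarrow> 0) at_top"
    by (intro filterlim_compose[OF exp_at_bot]) (simp add: top filterlim_uminus_at_bot)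
  have ebot: "((\<lambda>v. exp (- (x * exp v))) \<longlongrightarrow> exp (- (x * 0))) at_bot"
    by (intro tendsto_intros exp_at_bot)
  have "(LBINT v=-\<infinity>..\<infinity>. ?k v - ?g v) = 0 - 0"
  proof (rule interval_integral_FTC_integrable)
    show "((\<lambda>v. exp (- (x * exp v)) * strip_cdf \<alpha> v) has_vector_derivative (?k v - ?g v)) (at v)" for v
      unfolding has_real_derivative_iff_has_vector_derivative[symmetric]
      by (rule derivative_eq_intros strip_cdf_deriv[OF assms(1,2)] refl | simp)+
    show "isCont (\<lambda>v. ?k v - ?g v) v" for v
    proof -
      have "isCont (strip_kernel \<alpha>) v" "isCont (strip_cdf \<alpha>) v"
        using continuous_on_strip_kernel[OF assms(1,2), of UNIV] strip_cdf_continuous[OF assms(1,2), of UNIV]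
        by (auto simp: continuous_on_eq_continuous_at)
      then show ?thesis by (intro continuous_intros)
    qed
    show "set_integrable lborel (einterval (-\<infinity>) \<infinity>) (\<lambda>v. ?k v - ?g v)"
      using k g by (simp add: set_integrable_def)
    show "(((\<lambda>v. exp (- (x * exp v)) * strip_cdf \<alpha> v) \<circ> real_of_ereal) \<longlongrightarrow> 0) (at_right (-\<infinity>))"
      using tendsto_mult[OF ebot strip_cdf_at_bot[OF assms(1,2)]] by (simp add: ereal_tendsto_simps)
    show "(((\<lambda>v. exp (- (x * exp v)) * strip_cdf \<alpha> v) \<circ> real_of_ereal) \<longlongrightarrow> 0) (at_left \<infinity>)"
      using tendsto_mult[OF etop strip_cdf_at_top[OF assms(1,2)]] by (simp add: ereal_tendsto_simps)
  qed simp
  then have "(LINT v|lborel. ?k v - ?g v) = 0"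
    by (simp add: interval_integral_to_infinity_eq interval_lebesgue_integral_def set_lebesgue_integral_def)
  then show ?thesis
    using k g by (simp add: has_bochner_integral_iff strip_laplace_def)
qed

definition strip_gap :: "real \<Rightarrow> real \<Rightarrow> real \<Rightarrow> real" where
  "strip_gap \<alpha> \<beta> v = strip_cdf \<alpha> v - strip_cdf \<beta> v"

lemma strip_gap_minus:
  assumes "0 < \<alpha>" "\<alpha> < \<beta>" "\<beta> < 1"
  shows "strip_gap \<alpha> \<beta> (- v) = - strip_gap \<alpha> \<beta> v"
  using assms by (simp add: strip_gap_def strip_cdf_reflect)

lemma strip_gap_sign:
  assumes "0 < \<alpha>" "\<alpha> < \<beta>" "\<beta> < 1"
  shows "0 < v \<Longrightarrow> strip_gap \<alpha> \<beta> v < 0" "v < 0 \<Longrightarrow> 0 < strip_gap \<alpha> \<beta> v" "strip_gap \<alpha> \<beta> 0 = 0"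
proof -
  show neg: "strip_gap \<alpha> \<beta> v < 0" if "0 < v" for v
    using strip_cdf_less[OF assms that] by (simp add: strip_gap_def)
  show "0 < strip_gap \<alpha> \<beta> v" if "v < 0"
    using neg[of "- v"] that strip_gap_minus[OF assms, of v] by simp
  show "strip_gap \<alpha> \<beta> 0 = 0"
    using strip_gap_minus[OF assms, of 0] by simp
qed

text \<open>The factor exp x / x leaves x only in exp(x (1 - exp v)), whose monotonicity in x is
  decided by the sign of v, as is the sign of the gap.\<close>

lemma strip_laplace_diff:
  assumes "0 < \<alpha>" "\<alpha> < \<beta>" "\<beta> < 1" "0 < x"
  shows "has_bochner_integral lborel (\<lambda>v. exp v * exp (x * (1 - exp v)) * strip_gap \<alpha> \<beta> v)
           (exp x / x * (strip_laplace \<alpha> x - strip_laplace \<beta> x))"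
proof -
  have "has_bochner_integral lborel
      (\<lambda>v. exp x / x * (x * exp v * exp (- (x * exp v)) * strip_cdf \<alpha> v - x * exp v * exp (- (x * exp v)) * strip_cdf \<beta> v))
      (exp x / x * (strip_laplace \<alpha> x - strip_laplace \<beta> x))"
    using assms by (intro has_bochner_integral_mult_right has_bochner_integral_diff strip_laplace_cdf) auto
  also have "(\<lambda>v. exp x / x * (x * exp v * exp (- (x * exp v)) * strip_cdf \<alpha> v - x * exp v * exp (- (x * exp v)) * strip_cdf \<beta> v))
     = (\<lambda>v. exp v * exp (x * (1 - exp v)) * strip_gap \<alpha> \<beta> v)"
  proof
    fix v
    have "exp (x * (1 - exp v)) = exp x * exp (- (x * exp v))"
      by (simp add: algebra_simps flip: exp_add)
    then show "exp x / x * (x * exp v * exp (- (x * exp v)) * strip_cdf \<alpha> v - x * exp v * exp (- (x * exp v)) * strip_cdf \<beta> v)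
      = exp v * exp (x * (1 - exp v)) * strip_gap \<alpha> \<beta> v"
      using assms(4) by (simp add: strip_gap_def field_simps)
  qed
  finally show ?thesis .
qed

text \<open>For v > 0 the exponential decreases in x and the gap is negative; for v < 0 both are
  reversed. So the integrand increases in x at every v other than 0.\<close>

lemma strip_laplace_diff_strict_mono:
  assumes "0 < \<alpha>" "\<alpha> < \<beta>" "\<beta> < 1" "0 < x" "x < y"
  shows "exp x / x * (strip_laplace \<alpha> x - strip_laplace \<beta> x) < exp y / y * (strip_laplace \<alpha> y - strip_laplace \<beta> y)"
proof -
  note H = strip_gap_sign[OF assms(1-3)]
  have y: "0 < y" using assms by simp
  let ?f = "\<lambda>v. exp v * exp (y * (1 - exp v)) * strip_gap \<alpha> \<beta> v - exp v * exp (x * (1 - exp v)) * strip_gap \<alpha> \<beta> v"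
  have b: "has_bochner_integral lborel ?f (exp y / y * (strip_laplace \<alpha> y - strip_laplace \<beta> y) - exp x / x * (strip_laplace \<alpha> x - strip_laplace \<beta> x))"
    by (intro has_bochner_integral_diff strip_laplace_diff assms y)
  have f: "?f v = exp v * ((exp (y * (1 - exp v)) - exp (x * (1 - exp v))) * strip_gap \<alpha> \<beta> v)" for v
    by (simp add: algebra_simps)
  have pos: "0 < ?f v" if "v \<noteq> 0" for v
    unfolding f
  proof (rule mult_pos_pos)
    show "0 < (exp (y * (1 - exp v)) - exp (x * (1 - exp v))) * strip_gap \<alpha> \<beta> v"
    proof (cases "0 < v")
      case True
      then have "y * (1 - exp v) < x * (1 - exp v)"
        using assms by (intro mult_strict_right_mono_neg) auto
      then show ?thesis using H(1)[OF True] by (intro mult_neg_neg) auto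
    next
      case False
      then have v: "v < 0" using that by simp
      then have "x * (1 - exp v) < y * (1 - exp v)"
        using assms by (intro mult_strict_right_mono) auto
      then show ?thesis using H(2)[OF v] by (intro mult_pos_pos) auto
    qed
  qed simp
  have "0 < (LINT v|lborel. ?f v)"
  proof (rule integral_lborel_pos[of _ 0 1])
    show "0 \<le> ?f v" for v
      using pos[of v] by (cases "v = 0") (auto simp: H(3))
  qed (use b pos in \<open>auto simp: has_bochner_integral_iff\<close>)
  then show ?thesis
    using has_bochner_integral_integral_eq[OF b] by simp
qed

lemma exp_diff_exp_minus_greater:
  fixes v :: real
  assumes "0 < v"
  shows "2 * v < exp v - exp (- v)"
proof -
  have "exp 0 - exp (- 0) - 2 * 0 < exp v - exp (- v) - 2 * v"
  proof (rule DERIV_pos_imp_increasing_open[OF assms])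
    fix t :: real assume t: "0 < t" "t < v"
    have "((\<lambda>v. exp v - exp (- v) - 2 * v) has_real_derivative exp t + exp (- t) - 2) (at t)"
      by (auto intro!: derivative_eq_intros)
    moreover have "0 < exp t + exp (- t) - 2"
    proof -
      have "0 < (exp (t / 2) - exp (- (t / 2)))\<^sup>2" using t by simp
      also have "\<dots> = exp t + exp (- t) - 2"
        by (simp add: power2_eq_square algebra_simps flip: exp_add)
      finally show ?thesis .
    qed
    ultimately show "\<exists>y. ((\<lambda>v. exp v - exp (- v) - 2 * v) has_real_derivative y) (at t) \<and> 0 < y"
      by blast
  qed (intro continuous_intros)
  then show ?thesis by simp
qed

text \<open>The integral is folded by v -> -v. As the gap is odd, the sign depends on
  \<open>g v - g (- v)\<close>, and for v > 0 the inequality \<open>g v < g (- v)\<close> amounts to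
  v < sinh v.\<close>

lemma strip_laplace_less_at_1:
  assumes "0 < \<alpha>" "\<alpha> < \<beta>" "\<beta> < 1"
  shows "strip_laplace \<beta> 1 < strip_laplace \<alpha> 1"
proof -
  note H = strip_gap_sign[OF assms]
  define g where "g v = exp v * exp (1 * (1 - exp v))" for v :: real
  let ?J = "strip_laplace \<alpha> 1 - strip_laplace \<beta> 1"
  have b: "has_bochner_integral lborel (\<lambda>v. g v * strip_gap \<alpha> \<beta> v) (exp 1 / 1 * ?J)"
    unfolding g_def by (intro strip_laplace_diff assms) simp
  have "has_bochner_integral lborel (\<lambda>v. g (0 + (-1) * v) * strip_gap \<alpha> \<beta> (0 + (-1) * v)) ((exp 1 / 1 * ?J) /\<^sub>R \<bar>-1\<bar>)"
    by (rule lborel_has_bochner_integral_real_affine_iff[THEN iffD1, OF _ b]) simp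
  then have b': "has_bochner_integral lborel (\<lambda>v. g (- v) * - strip_gap \<alpha> \<beta> v) (exp 1 * ?J)"
    by (simp add: strip_gap_minus[OF assms])
  have c: "has_bochner_integral lborel (\<lambda>v. (g v - g (- v)) * strip_gap \<alpha> \<beta> v) (2 * exp 1 * ?J)"
    using has_bochner_integral_add[OF b b'] by (simp add: algebra_simps)
  have g: "g v < g (- v)" if "0 < v" for v
    using exp_diff_exp_minus_greater[OF that] by (simp add: g_def flip: exp_add)
  have pos: "0 < (g v - g (- v)) * strip_gap \<alpha> \<beta> v" if "v \<noteq> 0" for v
  proof (cases "0 < v")
    case True
    then show ?thesis using g H(1) by (intro mult_neg_neg) auto
  next
    case False
    then show ?thesis using g[of "- v"] H(2) that by (intro mult_pos_pos) auto
  qed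
  have "0 < (LINT v|lborel. (g v - g (- v)) * strip_gap \<alpha> \<beta> v)"
  proof (rule integral_lborel_pos[of _ 0 1])
    show "0 \<le> (g v - g (- v)) * strip_gap \<alpha> \<beta> v" for v
      using pos[of v] by (cases "v = 0") auto
  qed (use c pos in \<open>auto simp: has_bochner_integral_iff\<close>)
  then have "0 < 2 * exp 1 * ?J"
    using has_bochner_integral_integral_eq[OF c] by simp
  then show ?thesis by (simp add: zero_less_mult_iff)
qed

section \<open>Lower and upper bounds for the zero\<close>

lemma strip_laplace_less_small:
  assumes "0 < \<alpha>" "\<alpha> < \<beta>" "\<beta> < 1" "0 < x"
    and "x powr (\<beta> - \<alpha>) \<le> 1 / (Gamma (1 - \<beta>) * Gamma (1 + \<alpha>))"
  shows "strip_laplace \<alpha> x < strip_laplace \<beta> x"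
proof -
  define A where "A = x powr \<alpha> / Gamma (1 + \<alpha>)"
  define B where "B = Gamma (1 - \<beta>) * x powr \<beta>"
  have G: "0 < Gamma (1 - \<beta>)" "0 < Gamma (1 + \<alpha>)" using assms by (auto intro!: Gamma_real_pos)
  have A: "0 < A" using G assms by (simp add: A_def)
  \<comment> \<open>The hypothesis on x says exactly that B \<le> A. The two one-sided estimates
    then compare as (1 + A) e_\<alpha> < 1 \<le> (1 + B) e_\<beta>, where e_\<gamma> is
    \<open>strip_laplace \<gamma> x\<close>.\<close>
  have "B = Gamma (1 - \<beta>) * x powr \<alpha> * x powr (\<beta> - \<alpha>)"
    by (simp add: B_def mult.assoc flip: powr_add)
  also have "\<dots> \<le> Gamma (1 - \<beta>) * x powr \<alpha> * (1 / (Gamma (1 - \<beta>) * Gamma (1 + \<alpha>)))"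
    using assms G by (intro mult_left_mono) auto
  also have "\<dots> = A" using G by (simp add: A_def)
  finally have BA: "B \<le> A" .
  have 1: "(1 + A) * strip_laplace \<alpha> x < 1"
    using one_minus_strip_laplace_greater[of \<alpha> x] assms by (simp add: A_def algebra_simps)
  have "1 \<le> (1 + B) * strip_laplace \<beta> x"
    using one_minus_strip_laplace_le[of \<beta> x] assms by (simp add: B_def algebra_simps)
  also have "\<dots> \<le> (1 + A) * strip_laplace \<beta> x"
    using BA strip_laplace_pos[of \<beta> x] assms by (intro mult_right_mono) auto
  finally have "(1 + A) * strip_laplace \<alpha> x < (1 + A) * strip_laplace \<beta> x" using 1 by linarith
  then show ?thesis using A by simp
qed

text \<open>The density of the Volterra kernel becomes more concentrated near the end point \<open>u = 1\<close> when its
  exponent decreases.\<close>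

lemma powr_density_mono:
  fixes f :: "real \<Rightarrow> real"
  assumes "0 < \<alpha>" "\<alpha> < \<beta>"
    and anti: "\<And>u u'. 0 < u \<Longrightarrow> u \<le> u' \<Longrightarrow> u' < 1 \<Longrightarrow> f u' \<le> f u"
    and i: "integrable lborel (\<lambda>u. indicator {0<..<1} u * (\<alpha> * (1 - u) powr (\<alpha> - 1)) * f u)"
    and j: "integrable lborel (\<lambda>u. indicator {0<..<1} u * (\<beta> * (1 - u) powr (\<beta> - 1)) * f u)"
  shows "(LINT u|lborel. indicator {0<..<1} u * (\<alpha> * (1 - u) powr (\<alpha> - 1)) * f u)
     \<le> (LINT u|lborel. indicator {0<..<1} u * (\<beta> * (1 - u) powr (\<beta> - 1)) * f u)"
proof -
  define p where "p \<gamma> u = indicator {0<..<1} u * (\<gamma> * (1 - u) powr (\<gamma> - 1))" for \<gamma> u :: real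
  \<comment> \<open>The two densities agree exactly at u = 1 - r; the one with exponent \<beta> is
    larger to the left of this point and smaller to the right.\<close>
  define r where "r = (\<alpha> / \<beta>) powr (1 / (\<beta> - \<alpha>))"
  have r: "0 < r" "r < 1"
    using assms powr_less_mono2[of "1 / (\<beta> - \<alpha>)" "\<alpha> / \<beta>" 1] by (auto simp: r_def)
  have rp: "r powr (\<beta> - \<alpha>) = \<alpha> / \<beta>" using assms by (simp add: r_def powr_powr)
  have split: "\<beta> * t powr (\<beta> - 1) - \<alpha> * t powr (\<alpha> - 1) = \<beta> * t powr (\<alpha> - 1) * (t powr (\<beta> - \<alpha>) - r powr (\<beta> - \<alpha>))"
    if "0 < t" for t
    unfolding rp using assms by (simp add: right_diff_distrib mult.assoc flip: powr_add)
  have 1: "has_bochner_integral lborel (p \<gamma>) 1" if "0 < \<gamma>" for \<gamma>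
    unfolding p_def[abs_def] by (rule has_bochner_integral_powr_density) fact
  have \<beta>: "0 < \<beta>" using assms by simp
  \<comment> \<open>Both densities have mass 1, so subtracting the constant \<open>f (1 - r)\<close>
    costs nothing. Afterwards both factors of the integrand change sign at 1 - r.\<close>
  have c: "has_bochner_integral lborel (\<lambda>u. (p \<beta> u - p \<alpha> u) * f (1 - r)) ((1 - 1) * f (1 - r))"
    by (intro has_bochner_integral_mult_left has_bochner_integral_diff 1 assms \<beta>)
  have nn: "0 \<le> (p \<beta> u * f u - p \<alpha> u * f u) - (p \<beta> u - p \<alpha> u) * f (1 - r)" for u
  proof (cases "0 < u \<and> u < 1")
    case True
    have eq: "(p \<beta> u * f u - p \<alpha> u * f u) - (p \<beta> u - p \<alpha> u) * f (1 - r) = (p \<beta> u - p \<alpha> u) * (f u - f (1 - r))"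
      by (simp add: algebra_simps)
    have p: "p \<beta> u - p \<alpha> u = \<beta> * (1 - u) powr (\<alpha> - 1) * ((1 - u) powr (\<beta> - \<alpha>) - r powr (\<beta> - \<alpha>))"
      using True split[of "1 - u"] by (simp add: p_def)
    show ?thesis
    proof (cases "u \<le> 1 - r")
      case le: True
      have "r powr (\<beta> - \<alpha>) \<le> (1 - u) powr (\<beta> - \<alpha>)" using le r assms by (intro powr_mono2) auto
      moreover have "f (1 - r) \<le> f u" using True le r by (intro anti) auto
      ultimately have "0 \<le> (p \<beta> u - p \<alpha> u) * (f u - f (1 - r))"
        unfolding p using \<beta> by (intro mult_nonneg_nonneg) auto
      then show ?thesis using eq by simp
    next
      case gt: False
      have "(1 - u) powr (\<beta> - \<alpha>) \<le> r powr (\<beta> - \<alpha>)" using True gt r assms by (intro powr_mono2) auto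
      moreover have "f u \<le> f (1 - r)" using True gt r by (intro anti) auto
      ultimately have "0 \<le> (p \<beta> u - p \<alpha> u) * (f u - f (1 - r))"
        unfolding p using \<beta> by (intro mult_nonpos_nonpos[OF mult_nonneg_nonpos]) auto
      then show ?thesis using eq by simp
    qed
  qed (simp add: p_def)
  have ip: "integrable lborel (\<lambda>u. p \<alpha> u * f u)" "integrable lborel (\<lambda>u. p \<beta> u * f u)"
    using i j by (simp_all add: p_def)
  have "0 \<le> (LINT u|lborel. (p \<beta> u * f u - p \<alpha> u * f u) - (p \<beta> u - p \<alpha> u) * f (1 - r))"
    using nn by (intro integral_nonneg_AE AE_I2)
  also have "\<dots> = (LINT u|lborel. p \<beta> u * f u) - (LINT u|lborel. p \<alpha> u * f u)"
    using ip c by (simp add: has_bochner_integral_iff)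
  finally show ?thesis by (simp add: p_def)
qed

text \<open>With \<open>I \<gamma> \<delta>\<close> the integral of the solution for \<delta>
  against the Volterra weight for \<gamma>, one has I \<alpha> \<alpha> < I \<alpha> \<beta> because
  of the order below x, and I \<alpha> \<beta> \<le> I \<beta> \<beta> by
  \<open>powr_density_mono\<close>. At a common value the Volterra equations express the two outer
  integrals through the same factor.\<close>

lemma strip_laplace_crossing_less:
  assumes "0 < \<alpha>" "\<alpha> < \<beta>" "\<beta> < 1" "0 < x"
    and eq: "strip_laplace \<alpha> x = strip_laplace \<beta> x"
    and less: "\<And>t. 0 < t \<Longrightarrow> t < x \<Longrightarrow> strip_laplace \<alpha> t < strip_laplace \<beta> t"
  shows "Gamma (1 + \<alpha>) * x powr \<beta> < Gamma (1 + \<beta>) * x powr \<alpha>"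
proof (rule ccontr)
  assume neg: "\<not> ?thesis"
  have ab: "\<alpha> < 1" "0 < \<beta>" using assms by auto
  define I where "I \<gamma> \<delta> = (LINT u|lborel. indicator {0<..<1} u * (\<gamma> * (1 - u) powr (\<gamma> - 1)) * strip_laplace \<delta> (x * u))" for \<gamma> \<delta>
  let ?w = "\<lambda>u. indicator {0<..<1} u * (\<alpha> * (1 - u) powr (\<alpha> - 1))"
  note va = strip_laplace_volterra[OF assms(1) ab(1) assms(4)]
  note vb = strip_laplace_volterra[OF ab(2) assms(3) assms(4)]
  have Ia: "I \<alpha> \<alpha> = Gamma (1 + \<alpha>) / x powr \<alpha> * (1 - strip_laplace \<alpha> x)"
    unfolding I_def by (rule has_bochner_integral_integral_eq[OF va])
  have Ib: "I \<beta> \<beta> = Gamma (1 + \<beta>) / x powr \<beta> * (1 - strip_laplace \<alpha> x)"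
    unfolding I_def eq by (rule has_bochner_integral_integral_eq[OF vb])
  have iab: "integrable lborel (\<lambda>u. ?w u * strip_laplace \<beta> (x * u))"
  proof (rule Bochner_Integration.integrable_bound)
    let ?K = "integral\<^sup>L lborel (strip_kernel \<beta>)"
    show "integrable lborel (\<lambda>u. ?w u * ?K)"
      using has_bochner_integral_powr_density[OF assms(1)] by (simp add: has_bochner_integral_iff)
    have "continuous_on {0<..<1} (\<lambda>u. strip_laplace \<beta> (x * u))"
      using assms by (intro continuous_on_compose2[OF continuous_on_strip_laplace[OF ab(2) assms(3)]] continuous_intros) auto
    then have [measurable]: "(\<lambda>u. indicator {0<..<1} u *\<^sub>R strip_laplace \<beta> (x * u)) \<in> borel_measurable borel"
      by (intro borel_measurable_continuous_on_indicator) auto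
    have "(\<lambda>u. (\<alpha> * (1 - u) powr (\<alpha> - 1)) * (indicator {0<..<1} u *\<^sub>R strip_laplace \<beta> (x * u))) \<in> borel_measurable borel"
      by measurable
    then show "(\<lambda>u. ?w u * strip_laplace \<beta> (x * u)) \<in> borel_measurable lborel"
      by (simp add: mult_ac)
    show "AE u in lborel. norm (?w u * strip_laplace \<beta> (x * u)) \<le> norm (?w u * ?K)"
    proof (intro AE_I2)
      fix u :: real
      show "norm (?w u * strip_laplace \<beta> (x * u)) \<le> norm (?w u * ?K)"
        using strip_laplace_bounds[OF ab(2) assms(3), of "x * u"] assms
        by (cases "0 < u \<and> u < 1") (auto simp: abs_mult intro!: mult_left_mono)
    qed
  qed
  have "I \<alpha> \<alpha> < I \<alpha> \<beta>"
  proof -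
    have "0 < (LINT u|lborel. ?w u * strip_laplace \<beta> (x * u) - ?w u * strip_laplace \<alpha> (x * u))"
    proof (rule integral_lborel_pos[of _ 0 1])
      show "integrable lborel (\<lambda>u. ?w u * strip_laplace \<beta> (x * u) - ?w u * strip_laplace \<alpha> (x * u))"
        using iab va by (simp add: has_bochner_integral_iff)
      show pos: "0 < ?w u * strip_laplace \<beta> (x * u) - ?w u * strip_laplace \<alpha> (x * u)" if "0 < u" "u < 1" for u
        using that less[of "x * u"] assms by (simp flip: right_diff_distrib)
      show "0 \<le> ?w u * strip_laplace \<beta> (x * u) - ?w u * strip_laplace \<alpha> (x * u)" for u
        using pos[of u] by (cases "0 < u \<and> u < 1") auto
    qed simp
    then show ?thesis
      using iab va by (simp add: I_def has_bochner_integral_iff)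
  qed
  also have "I \<alpha> \<beta> \<le> I \<beta> \<beta>"
    unfolding I_def
  proof (rule powr_density_mono[OF assms(1,2) _ iab])
    show "strip_laplace \<beta> (x * u') \<le> strip_laplace \<beta> (x * u)" if "0 < u" "u \<le> u'" "u' < 1" for u u'
      using strip_laplace_strict_antimono[OF ab(2) assms(3), of "x * u" "x * u'"] that assms(4)
      by (cases "u = u'") auto
    show "integrable lborel (\<lambda>u. indicator {0<..<1} u * (\<beta> * (1 - u) powr (\<beta> - 1)) * strip_laplace \<beta> (x * u))"
      using vb by (simp add: has_bochner_integral_iff)
  qed
  finally have lt: "Gamma (1 + \<alpha>) / x powr \<alpha> * (1 - strip_laplace \<alpha> x) < Gamma (1 + \<beta>) / x powr \<beta> * (1 - strip_laplace \<alpha> x)"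
    unfolding Ia Ib .
  have "0 < x powr \<alpha> / Gamma (1 + \<alpha>) * strip_laplace \<alpha> x"
    using assms ab strip_laplace_pos[of \<alpha> x] by (intro mult_pos_pos divide_pos_pos Gamma_real_pos) auto
  \<comment> \<open>Positivity of the common factor allows it to be cancelled from
    \<open>lt\<close>.\<close>
  then have "0 < 1 - strip_laplace \<alpha> x"
    using one_minus_strip_laplace_greater[OF assms(1) ab(1) assms(4)] by linarith
  with lt have "Gamma (1 + \<alpha>) / x powr \<alpha> < Gamma (1 + \<beta>) / x powr \<beta>"
    by (intro mult_right_less_imp_less[OF lt]) simp
  then show False using neg assms(4) by (simp add: field_simps)
qed

lemma less_powr_inverse_iff:
  fixes x t c :: real
  assumes "0 < x" "0 < t" "0 < c"
  shows "x < t powr (1 / c) \<longleftrightarrow> x powr c < t"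
proof -
  have "x = (x powr c) powr (1 / c)" using assms by (simp add: powr_powr)
  then show ?thesis
    using assms powr_less_mono2[of "1 / c"] powr_mono2[of "1 / c"]
    by (smt (verit, ccfv_threshold) divide_pos_pos powr_ge_zero)
qed

theorem theoremB:
  fixes \<alpha> \<beta> :: real
  assumes "0 < \<alpha>" and "\<alpha> < \<beta>" and "\<beta> < 1"
  shows "\<exists>x0. 0 < x0 \<and> x0 < 1 \<and>
     (\<forall>x. 0 < x \<and> x < x0 \<longrightarrow>
        mittag_leffler \<alpha> (- (x powr \<alpha>)) - mittag_leffler \<beta> (- (x powr \<beta>)) < 0) \<and>
     (\<forall>x. x0 < x \<longrightarrow>
        mittag_leffler \<alpha> (- (x powr \<alpha>)) - mittag_leffler \<beta> (- (x powr \<beta>)) > 0) \<and>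
     (1 / (Gamma (1 - \<beta>) * Gamma (1 + \<alpha>))) powr (1 / (\<beta> - \<alpha>)) < x0 \<and>
     x0 < (Gamma (1 + \<beta>) / Gamma (1 + \<alpha>)) powr (1 / (\<beta> - \<alpha>))"
proof -
  define d where "d x = strip_laplace \<alpha> x - strip_laplace \<beta> x" for x
  define L where "L = (1 / (Gamma (1 - \<beta>) * Gamma (1 + \<alpha>))) powr (1 / (\<beta> - \<alpha>))"
  have ab: "\<alpha> < 1" "0 < \<beta>" using assms by auto
  have d: "mittag_leffler \<alpha> (- (x powr \<alpha>)) - mittag_leffler \<beta> (- (x powr \<beta>)) = d x" if "0 < x" for x
    using that assms ab by (simp add: d_def mittag_leffler_eq_strip_laplace)
  have G: "0 < Gamma (1 - \<beta>)" "0 < Gamma (1 + \<alpha>)" "0 < Gamma (1 + \<beta>)"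
    using assms by (auto intro!: Gamma_real_pos)
  have L0: "0 < L" using G by (simp add: L_def)
  have Lp: "L powr (\<beta> - \<alpha>) = 1 / (Gamma (1 - \<beta>) * Gamma (1 + \<alpha>))"
    using assms G by (simp add: L_def powr_powr)
  \<comment> \<open>The endpoint \<open>x = L\<close> is included; this later excludes
    \<open>x0 = L\<close> and makes the lower bound strict.\<close>
  have dneg: "d x < 0" if "0 < x" "x \<le> L" for x
    using strip_laplace_less_small[OF assms that(1)] powr_mono2[of "\<beta> - \<alpha>" x L] that assms Lp
    by (simp add: d_def)
  have d1: "0 < d 1" using strip_laplace_less_at_1[OF assms] by (simp add: d_def)
  have L1: "L < 1" using dneg[of 1] d1 by force
  have "continuous_on {L..1} d"
    unfolding d_def using L0 assms ab
    by (intro continuous_on_diff continuous_on_subset[OF continuous_on_strip_laplace]) auto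
  then obtain x0 where x0: "L \<le> x0" "x0 \<le> 1" "d x0 = 0"
    using IVT'[of d L 0 1] dneg[OF L0] d1 L1 by force
  have x0': "0 < x0" using x0 L0 by simp
  have L_less: "L < x0" using x0 dneg[of L] L0 by (cases "L = x0") auto
  have x01: "x0 < 1" using x0 d1 by (cases "x0 = 1") auto
  \<comment> \<open>The product of exp x / x and \<open>d x\<close> is strictly increasing and
    vanishes at \<open>x0\<close>, so \<open>d\<close> has the sign of x - x0 on both sides.\<close>
  have below: "d x < 0" if "0 < x" "x < x0" for x
    using strip_laplace_diff_strict_mono[OF assms that] x0(3) that(1)
    by (simp add: d_def mult_less_0_iff divide_less_0_iff)
  have above: "0 < d x" if "x0 < x" for x
    using strip_laplace_diff_strict_mono[OF assms x0' that] x0(3) that x0'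
    by (simp add: d_def zero_less_mult_iff zero_less_divide_iff)
  have "Gamma (1 + \<alpha>) * x0 powr \<beta> < Gamma (1 + \<beta>) * x0 powr \<alpha>"
    using strip_laplace_crossing_less[OF assms x0'] x0(3) below by (simp add: d_def)
  then have "x0 powr (\<beta> - \<alpha>) < Gamma (1 + \<beta>) / Gamma (1 + \<alpha>)"
    using G x0' by (simp add: powr_diff field_simps)
  then have "x0 < (Gamma (1 + \<beta>) / Gamma (1 + \<alpha>)) powr (1 / (\<beta> - \<alpha>))"
    using G x0' assms by (simp add: less_powr_inverse_iff)
  then show ?thesis
    using x0' x01 L_less below above d unfolding L_def by (intro exI[of _ x0]) auto
qed

end
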